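(* Let $(\mathfrak g,s)$ be a semisimple, orthogonal, symmetric Lie algebra with Cartan-like decomposition $\mathfrak g=\mathfrak k\oplus\mathfrak p$. Then there exist symmetric Lie subalgebras $(\mathfrak g_i,s|_{\mathfrak g_i})$, $i=1,\ldots,n$, of $(\mathfrak g,s)$ which are irreducible orthogonal symmetric Lie algebras, with Cartan-like decompositions $\mathfrak g_i=\mathfrak k_i\oplus\mathfrak p_i$, and a symmetric Lie subalgebra $(\mathfrak g',s|_{\mathfrak g'})$ with Cartan-like decomposition $\mathfrak g'=\mathfrak k'\oplus\mathfrak p'$ and with trivial isotropy representation, such that $$\mathfrak p=\bigoplus_{i=1}^n\mathfrak p_i\oplus\mathfrak p'$$ and such that the isotropy representation of $(\mathfrak g,s)$ is orbit equivalent to the isotropy representation of the (external) direct sum $\bigoplus_{i=1}^n(\mathfrak g_i,s|_{\mathfrak g_i})\oplus(\mathfrak g',s|_{\mathfrak g'})$.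
   Context: A symmetric Lie algebra $(\mathfrak g,s)$ is a real finite-dimensional Lie algebra $\mathfrak g$ with an involutive Lie algebra automorphism $s$; $\mathfrak k$ and $\mathfrak p$ denote the $+1$ and $-1$ eigenspaces of $s$, and $\mathfrak g=\mathfrak k\oplus\mathfrak p$ is the Cartan-like decomposition. It is semisimple if $\mathfrak g$ is; orthogonal if the connected Lie subgroup $\mathrm{Int}_{\mathfrak k}(\mathfrak g)\subseteq \mathrm{GL}(\mathfrak g)$ with Lie algebra $\mathrm{ad}_{\mathfrak k}$ is compact; strongly effective if $\mathfrak k$ contains no non-trivial ideal of $\mathfrak g$; irreducible if the adjoint representation of $\mathfrak k$ on $\mathfrak p$ is irreducible. An "irreducible orthogonal symmetric Lie algebra" is an orthogonal symmetric Lie algebra that is semisimple, strongly effective and irreducible. A symmetric Lie subalgebra of $(\mathfrak g,s)$ is an $s$-invariant Lie subalgebra $\mathfrak h$ with the automorphism $s|_{\mathfrak h}$; its Cartan-like decomposition is $\mathfrak h=(\mathfrak h\cap\mathfrak k)\oplus(\mathfrak h\cap\mathfrak p)$. The isotropy representation of $\mathfrak g=\mathfrak k\oplus\mathfrak p$ is the representation of $\mathrm{Int}_{\mathfrak k}(\mathfrak g)$ (infinitesimally, the adjoint representation of $\mathfrak k$) on $\mathfrak p$; it is trivial if $[\mathfrak k,\mathfrak p]=0$. Two group actions on the same set are orbit equivalent if they have the same orbits. Two symmetric Lie algebras $\mathfrak g_1=\mathfrak k_1\oplus\mathfrak p$ and $\mathfrak g_2=\mathfrak k_2\oplus\mathfrak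 p$ with the same $\mathfrak p$ are orbit equivalent if the actions of $\mathrm{Int}_{\mathfrak k_1}(\mathfrak g_1)$ and $\mathrm{Int}_{\mathfrak k_2}(\mathfrak g_2)$ on $\mathfrak p$ are orbit equivalent. The $-1$ eigenspace of the external direct sum is $\bigoplus_i\mathfrak p_i\oplus\mathfrak p'$, identified with $\mathfrak p$. *)

theory Defs
  imports
    "HOL-Analysis.Analysis"
    "HOL-Analysis.Finite_Function_Topology"
    "HOL-Algebra.Generated_Groups"
    "HOL-Algebra.Group_Action"
begin

text \<open>A Lie algebra is a finite-dimensional subspace \<open>\<gg>\<close> of a real vector space together with
  a bracket of which only the values on \<open>\<gg>\<close> matter. Using carriers rather than whole types lets
  subalgebras be Lie algebras in their own right and includes the zero Lie algebra.\<close>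

locale lie_algebra =
  fixes \<gg> :: "'a::real_vector set" and br :: "'a \<Rightarrow> 'a \<Rightarrow> 'a"
  assumes subspace: "subspace \<gg>"
    and finite_dimensional: "\<exists>B. finite B \<and> span B = \<gg>"
    and br_closed: "\<lbrakk>x \<in> \<gg>; y \<in> \<gg>\<rbrakk> \<Longrightarrow> br x y \<in> \<gg>"
    and br_add_left: "\<lbrakk>x \<in> \<gg>; y \<in> \<gg>; z \<in> \<gg>\<rbrakk> \<Longrightarrow> br (x + y) z = br x z + br y z"
    and br_add_right: "\<lbrakk>x \<in> \<gg>; y \<in> \<gg>; z \<in> \<gg>\<rbrakk> \<Longrightarrow> br x (y + z) = br x y + br x z"
    and br_scale_left: "\<lbrakk>x \<in> \<gg>; y \<in> \<gg>\<rbrakk> \<Longrightarrow> br (c *\<^sub>R x) y = c *\<^sub>R br x y"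
    and br_scale_right: "\<lbrakk>x \<in> \<gg>; y \<in> \<gg>\<rbrakk> \<Longrightarrow> br x (c *\<^sub>R y) = c *\<^sub>R br x y"
    and br_self: "x \<in> \<gg> \<Longrightarrow> br x x = 0"
    and jacobi: "\<lbrakk>x \<in> \<gg>; y \<in> \<gg>; z \<in> \<gg>\<rbrakk> \<Longrightarrow>
      br x (br y z) + br y (br z x) + br z (br x y) = 0"

text \<open>The identity is allowed as involution, so that restrictions of \<open>s\<close> to invariant subalgebras
  are covered.\<close>

locale symmetric_lie_algebra = lie_algebra \<gg> br
  for \<gg> :: "'a::real_vector set" and br :: "'a \<Rightarrow> 'a \<Rightarrow> 'a" +
  fixes s :: "'a \<Rightarrow> 'a"
  assumes s_closed: "x \<in> \<gg> \<Longrightarrow> s x \<in> \<gg>"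
    and s_add: "\<lbrakk>x \<in> \<gg>; y \<in> \<gg>\<rbrakk> \<Longrightarrow> s (x + y) = s x + s y"
    and s_scale: "x \<in> \<gg> \<Longrightarrow> s (c *\<^sub>R x) = c *\<^sub>R s x"
    and s_br: "\<lbrakk>x \<in> \<gg>; y \<in> \<gg>\<rbrakk> \<Longrightarrow> s (br x y) = br (s x) (s y)"
    and s_involutive: "x \<in> \<gg> \<Longrightarrow> s (s x) = x"

definition kpart :: "'a set \<Rightarrow> ('a \<Rightarrow> 'a) \<Rightarrow> 'a set" where
  "kpart \<gg> s = {x \<in> \<gg>. s x = x}"

definition ppart :: "'a::real_vector set \<Rightarrow> ('a \<Rightarrow> 'a) \<Rightarrow> 'a set" where
  "ppart \<gg> s = {x \<in> \<gg>. s x = - x}"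

definition symmetric_lie_subalgebra ::
  "'a::real_vector set \<Rightarrow> 'a set \<Rightarrow> ('a \<Rightarrow> 'a \<Rightarrow> 'a) \<Rightarrow> ('a \<Rightarrow> 'a) \<Rightarrow> bool" where
  "symmetric_lie_subalgebra \<hh> \<gg> br s \<longleftrightarrow>
    subspace \<hh> \<and> \<hh> \<subseteq> \<gg> \<and> (\<forall>x\<in>\<hh>. \<forall>y\<in>\<hh>. br x y \<in> \<hh>) \<and> (\<forall>x\<in>\<hh>. s x \<in> \<hh>)"

definition lie_ideal :: "'a::real_vector set \<Rightarrow> 'a set \<Rightarrow> ('a \<Rightarrow> 'a \<Rightarrow> 'a) \<Rightarrow> bool" where
  "lie_ideal I \<gg> br \<longleftrightarrow> subspace I \<and> I \<subseteq> \<gg> \<and> (\<forall>x\<in>\<gg>. \<forall>y\<in>I. br x y \<in> I)"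

definition derived_algebra :: "('a::real_vector \<Rightarrow> 'a \<Rightarrow> 'a) \<Rightarrow> 'a set \<Rightarrow> 'a set" where
  "derived_algebra br \<hh> = span {br x y | x y. x \<in> \<hh> \<and> y \<in> \<hh>}"

definition solvable_lie_algebra :: "'a::real_vector set \<Rightarrow> ('a \<Rightarrow> 'a \<Rightarrow> 'a) \<Rightarrow> bool" where
  "solvable_lie_algebra \<hh> br \<longleftrightarrow> (\<exists>n. (derived_algebra br ^^ n) \<hh> = {0})"

text \<open>Vanishing radical.\<close>

definition semisimple :: "'a::real_vector set \<Rightarrow> ('a \<Rightarrow> 'a \<Rightarrow> 'a) \<Rightarrow> bool" where
  "semisimple \<gg> br \<longleftrightarrow>
    (\<forall>I. lie_ideal I \<gg> br \<and> solvable_lie_algebra I br \<longrightarrow> I = {0})"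

definition exp_ad ::
  "'a::real_normed_vector set \<Rightarrow> ('a \<Rightarrow> 'a \<Rightarrow> 'a) \<Rightarrow> 'a \<Rightarrow> 'a \<Rightarrow> 'a" where
  "exp_ad \<gg> br x = (\<lambda>y\<in>\<gg>. suminf (\<lambda>n. (br x ^^ n) y /\<^sub>R fact n))"

text \<open>The connected Lie subgroup of \<open>GL(\<gg>)\<close> with Lie algebra \<open>ad \<kk>\<close> is the subgroup generated by
  the exponentials of elements of \<open>ad \<kk>\<close>. Its elements are represented as extensional
  functions on \<open>\<gg>\<close>.\<close>

definition Int_group ::
  "'a::real_normed_vector set \<Rightarrow> ('a \<Rightarrow> 'a \<Rightarrow> 'a) \<Rightarrow> 'a set \<Rightarrow> ('a \<Rightarrow> 'a) monoid" where
  "Int_group \<gg> br \<kk> =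
    BijGroup \<gg> \<lparr>carrier := generate (BijGroup \<gg>) {exp_ad \<gg> br x | x. x \<in> \<kk>}\<rparr>"

text \<open>Compactness refers to the topology of pointwise convergence on \<open>'a \<Rightarrow> 'a\<close>. All elements of the
  group agree outside \<open>\<gg>\<close>, and on linear endomorphisms of the finite-dimensional space \<open>\<gg>\<close> pointwise
  convergence is the usual vector space topology of \<open>End(\<gg>)\<close>.\<close>

definition orthogonal_symmetric ::
  "'a::real_normed_vector set \<Rightarrow> ('a \<Rightarrow> 'a \<Rightarrow> 'a) \<Rightarrow> ('a \<Rightarrow> 'a) \<Rightarrow> bool" where
  "orthogonal_symmetric \<gg> br s \<longleftrightarrow> compact (carrier (Int_group \<gg> br (kpart \<gg> s)))"

definition strongly_effective ::
  "'a::real_vector set \<Rightarrow> ('a \<Rightarrow> 'a \<Rightarrow> 'a) \<Rightarrow> ('a \<Rightarrow> 'a) \<Rightarrow> bool" where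
  "strongly_effective \<gg> br s \<longleftrightarrow> (\<forall>I. lie_ideal I \<gg> br \<and> I \<subseteq> kpart \<gg> s \<longrightarrow> I = {0})"

definition irreducible_symmetric ::
  "'a::real_vector set \<Rightarrow> ('a \<Rightarrow> 'a \<Rightarrow> 'a) \<Rightarrow> ('a \<Rightarrow> 'a) \<Rightarrow> bool" where
  "irreducible_symmetric \<gg> br s \<longleftrightarrow>
    ppart \<gg> s \<noteq> {0} \<and>
    (\<forall>V. subspace V \<and> V \<subseteq> ppart \<gg> s \<and> (\<forall>x\<in>kpart \<gg> s. \<forall>v\<in>V. br x v \<in> V)
      \<longrightarrow> V = {0} \<or> V = ppart \<gg> s)"

definition irreducible_orthogonal_symmetric_lie_algebra ::
  "'a::real_normed_vector set \<Rightarrow> ('a \<Rightarrow> 'a \<Rightarrow> 'a) \<Rightarrow> ('a \<Rightarrow> 'a) \<Rightarrow> bool" where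
  "irreducible_orthogonal_symmetric_lie_algebra \<gg> br s \<longleftrightarrow>
    symmetric_lie_algebra \<gg> br s \<and> orthogonal_symmetric \<gg> br s \<and> semisimple \<gg> br \<and>
    strongly_effective \<gg> br s \<and> irreducible_symmetric \<gg> br s"

definition trivial_isotropy ::
  "'a::real_vector set \<Rightarrow> ('a \<Rightarrow> 'a \<Rightarrow> 'a) \<Rightarrow> ('a \<Rightarrow> 'a) \<Rightarrow> bool" where
  "trivial_isotropy \<gg> br s \<longleftrightarrow> (\<forall>x\<in>kpart \<gg> s. \<forall>y\<in>ppart \<gg> s. br x y = 0)"

text \<open>The external direct sum of subspaces \<open>G 0, \<dots>, G (m - 1)\<close>, as families indexed by \<open>nat\<close> and
  supported on \<open>{..<m}\<close>, with componentwise bracket and involution.\<close>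

definition ext_sum :: "nat \<Rightarrow> (nat \<Rightarrow> 'a::zero set) \<Rightarrow> (nat \<Rightarrow>\<^sub>0 'a) set" where
  "ext_sum m G =
    {f. (\<forall>i<m. Poly_Mapping.lookup f i \<in> G i) \<and> (\<forall>i\<ge>m. Poly_Mapping.lookup f i = 0)}"

definition ext_br :: "nat \<Rightarrow> ('a \<Rightarrow> 'a \<Rightarrow> 'a) \<Rightarrow>
    (nat \<Rightarrow>\<^sub>0 'a::comm_monoid_add) \<Rightarrow> (nat \<Rightarrow>\<^sub>0 'a) \<Rightarrow> (nat \<Rightarrow>\<^sub>0 'a)" where
  "ext_br m br f h =
    (\<Sum>i<m. Poly_Mapping.single i (br (Poly_Mapping.lookup f i) (Poly_Mapping.lookup h i)))"

definition ext_inv :: "nat \<Rightarrow> ('a \<Rightarrow> 'a) \<Rightarrow>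
    (nat \<Rightarrow>\<^sub>0 'a::comm_monoid_add) \<Rightarrow> (nat \<Rightarrow>\<^sub>0 'a)" where
  "ext_inv m s f = (\<Sum>i<m. Poly_Mapping.single i (s (Poly_Mapping.lookup f i)))"

definition sum_map :: "nat \<Rightarrow> (nat \<Rightarrow>\<^sub>0 'a::comm_monoid_add) \<Rightarrow> 'a" where
  "sum_map m f = (\<Sum>i<m. Poly_Mapping.lookup f i)"

definition internal_direct_sum ::
  "nat \<Rightarrow> (nat \<Rightarrow> 'a::real_vector set) \<Rightarrow> 'a set \<Rightarrow> bool" where
  "internal_direct_sum m P V \<longleftrightarrow> bij_betw (sum_map m) (ext_sum m P) V"

definition isotropy_orbits :: "'a::real_normed_vector set \<Rightarrow> ('a \<Rightarrow> 'a \<Rightarrow> 'a) \<Rightarrow> ('a \<Rightarrow> 'a) \<Rightarrow>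
    'a set set" where
  "isotropy_orbits \<gg> br s =
    orbits (Int_group \<gg> br (kpart \<gg> s)) (ppart \<gg> s) (\<lambda>\<phi>. restrict \<phi> (ppart \<gg> s))"

text \<open>Orbit equivalence of two symmetric Lie algebras whose \<open>-1\<close> eigenspaces are identified by a
  bijection \<open>\<sigma>\<close>; for \<open>\<sigma> = id\<close> it says that the two actions on the same space have the
  same orbits.\<close>

definition orbit_equivalent_via ::
  "('b \<Rightarrow> 'a) \<Rightarrow> 'a::real_normed_vector set \<Rightarrow> ('a \<Rightarrow> 'a \<Rightarrow> 'a) \<Rightarrow> ('a \<Rightarrow> 'a) \<Rightarrow>
    'b::real_normed_vector set \<Rightarrow> ('b \<Rightarrow> 'b \<Rightarrow> 'b) \<Rightarrow> ('b \<Rightarrow> 'b) \<Rightarrow> bool" where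
  "orbit_equivalent_via \<sigma> \<gg>1 br1 s1 \<gg>2 br2 s2 \<longleftrightarrow>
    bij_betw \<sigma> (ppart \<gg>2 s2) (ppart \<gg>1 s1) \<and>
    isotropy_orbits \<gg>1 br1 s1 = (\<lambda>orb. \<sigma> ` orb) ` isotropy_orbits \<gg>2 br2 s2"

end

theory Submission
  imports Defs
begin

text \<open>Write \<open>\<gg> = \<kk> \<oplus> \<pp>\<close>. The compact group generated by the \<open>exp (ad x)\<close>, \<open>x \<in> \<kk>\<close>, leaves some inner
product \<open>q\<close> on \<open>\<gg>\<close> invariant (\<open>invariant_inner_product\<close>), so that \<open>ad x\<close> is \<open>q\<close>-skew for \<open>x \<in> \<kk>\<close>.
Therefore the Killing form \<open>B\<close> satisfies \<open>B x x = tr ((ad x)\<^sup>2) < 0\<close> for \<open>0 \<noteq> x \<in> \<kk>\<close>. On \<open>\<pp>\<close> it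
is nondegenerate: its radical in \<open>\<pp>\<close> is an abelian ideal of \<open>\<gg>\<close>, hence zero
(\<open>B_nondegenerate_p\<close>). This replaces Cartan's criterion.

Diagonalising \<open>B\<close> with respect to \<open>q\<close> shows that \<open>\<pp>\<close> is a direct sum of irreducible \<open>\<kk>\<close>-invariant
subspaces \<open>V\<^sub>i\<close> which are orthogonal for both forms (\<open>k_irreducible_decomposition\<close>). Different
summands commute: for \<open>u \<in> V\<^sub>i\<close>, \<open>v \<in> V\<^sub>j\<close> and \<open>y \<in> \<kk>\<close> the number \<open>B [u,v] y = B u [v,y]\<close> is zero
since \<open>[v,y] \<in> V\<^sub>j\<close>, and \<open>B\<close> is definite on \<open>\<kk>\<close>.

Put \<open>\<kk>\<^sub>i = [V\<^sub>i,V\<^sub>i]\<close> and \<open>\<gg>\<^sub>i = \<kk>\<^sub>i \<oplus> V\<^sub>i\<close>. The key point is that every element of \<open>\<gg>\<close> acts on \<open>\<gg>\<^sub>i\<close> as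
some element of \<open>\<gg>\<^sub>i\<close> does, and every element of \<open>\<kk>\<close> as some element of \<open>\<kk>\<^sub>i\<close> (\<open>k_part_acts\<close>,
\<open>algebra_acts\<close>): if \<open>x \<in> \<kk>\<close> is \<open>B\<close>-orthogonal to \<open>\<kk>\<^sub>i\<close>, then \<open>B [x,u] v = B x [u,v] = 0\<close> for
\<open>u, v \<in> V\<^sub>i\<close>, so \<open>[x,V\<^sub>i] = 0\<close> by nondegeneracy. Consequently ideals of \<open>\<gg>\<^sub>i\<close> are ideals of \<open>\<gg>\<close>, which
makes \<open>\<gg>\<^sub>i\<close> semisimple; \<open>\<kk>\<^sub>i\<close> and \<open>\<kk>\<close> have the same invariant subspaces in \<open>V\<^sub>i\<close>, which makes it
irreducible; and the group of \<open>\<gg>\<^sub>i\<close> consists of the restrictions to \<open>\<gg>\<^sub>i\<close> of the elements of the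
group of \<open>\<gg>\<close>, which makes it compact.

For the orbits, the action of \<open>x \<in> \<kk>\<close> on \<open>\<pp> = \<Oplus>V\<^sub>i\<close> agrees with that of a tuple
\<open>(x\<^sub>i) \<in> \<Oplus>\<kk>\<^sub>i\<close>, and conversely that of a tuple agrees with that of \<open>\<Sum>x\<^sub>i\<close>. The generators of
the two groups thus act on \<open>\<pp>\<close> by the same maps, and so do the groups
(\<open>orbit_equivalent_via_sum_map\<close>). The \<open>V\<^sub>i\<close> already exhaust \<open>\<pp>\<close>, so \<open>\<gg>'\<close> can be zero.\<close>

section \<open>The exponential function on linear endomorphisms\<close>

text \<open>The endomorphisms of a Euclidean space as a type of their own, so that composition can be the
multiplication of a Banach algebra. The exponential function of this algebra then supplies the
convergence, inverses and derivatives needed for \<open>exp (ad x)\<close>.\<close>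

typedef (overloaded) 'a endo = "UNIV :: ('a::euclidean_space \<Rightarrow>\<^sub>L 'a) set"
  morphisms blinfun_of Endo by simp

setup_lifting type_definition_endo

instantiation endo :: (euclidean_space) real_normed_algebra_1
begin

lift_definition norm_endo :: "'a endo \<Rightarrow> real" is norm .
lift_definition zero_endo :: "'a endo" is 0 .
lift_definition one_endo :: "'a endo" is id_blinfun .
lift_definition plus_endo :: "'a endo \<Rightarrow> 'a endo \<Rightarrow> 'a endo" is "(+)" .
lift_definition minus_endo :: "'a endo \<Rightarrow> 'a endo \<Rightarrow> 'a endo" is "(-)" .
lift_definition uminus_endo :: "'a endo \<Rightarrow> 'a endo" is uminus .
lift_definition scaleR_endo :: "real \<Rightarrow> 'a endo \<Rightarrow> 'a endo" is scaleR .
lift_definition times_endo :: "'a endo \<Rightarrow> 'a endo \<Rightarrow> 'a endo" is blinfun_compose .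

definition dist_endo :: "'a endo \<Rightarrow> 'a endo \<Rightarrow> real"
  where "dist_endo a b = norm (a - b)"

definition sgn_endo :: "'a endo \<Rightarrow> 'a endo"
  where "sgn_endo a = scaleR (inverse (norm a)) a"

definition [code del]:
  "(uniformity :: ('a endo \<times> 'a endo) filter) = (INF e\<in>{0 <..}. principal {(x, y). dist x y < e})"

definition open_endo :: "'a endo set \<Rightarrow> bool"
  where [code del]: "open_endo S = (\<forall>x\<in>S. \<forall>\<^sub>F (x', y) in uniformity. x' = x \<longrightarrow> y \<in> S)"

instance
proof
  show "norm (1::'a endo) = 1"
    by transfer simp
  show "(0::'a endo) \<noteq> 1"
    by transfer (metis norm_blinfun_id norm_zero zero_neq_one)
qed (unfold dist_endo_def open_endo_def sgn_endo_def uniformity_endo_def,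
   (rule refl | (transfer, (simp add: norm_triangle_ineq norm_blinfun_compose
        scaleR_add_left scaleR_add_right; fail))
     | (transfer, (auto intro!: blinfun_eqI simp: blinfun.bilinear_simps; fail)))+)

end

instance endo :: (euclidean_space) banach
proof
  fix X :: "nat \<Rightarrow> 'a endo"
  have norm_blinfun_of: "norm (blinfun_of a - blinfun_of b) = norm (a - b)" for a b :: "'a endo"
    by transfer simp
  assume "Cauchy X"
  then have "Cauchy (\<lambda>n. blinfun_of (X n))"
    by (simp add: Cauchy_iff norm_blinfun_of)
  then obtain L where L: "(\<lambda>n. blinfun_of (X n)) \<longlonglongrightarrow> L"
    using convergent_eq_Cauchy by blast
  have "norm (X n - Endo L) = norm (blinfun_of (X n) - L)" for n
    using norm_blinfun_of[of "X n" "Endo L"] by (simp add: Endo_inverse)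
  then have "X \<longlonglongrightarrow> Endo L"
    using L by (simp add: LIMSEQ_iff)
  then show "convergent X"
    by (auto simp: convergent_def)
qed

lift_definition endo_apply :: "'a::euclidean_space endo \<Rightarrow> 'a \<Rightarrow> 'a" is blinfun_apply .

lemma bounded_linear_endo_apply_left: "bounded_linear (\<lambda>A. endo_apply A y)"
proof
  show "endo_apply (A + B) y = endo_apply A y + endo_apply B y" for A B
    by transfer (simp add: blinfun.add_left)
  show "endo_apply (r *\<^sub>R A) y = r *\<^sub>R endo_apply A y" for r A
    by transfer (simp add: blinfun.scaleR_left)
  have "norm (endo_apply A y) \<le> norm A * norm y" for A
    by transfer (rule norm_blinfun)
  then show "\<exists>K. \<forall>A. norm (endo_apply A y) \<le> norm A * K"
    by blast
qed

lemma linear_endo_apply: "linear (endo_apply A)"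
  by transfer (simp add: bounded_linear.linear blinfun.bounded_linear_right)

lemma endo_apply_one [simp]: "endo_apply 1 y = y"
  by transfer simp

lemma endo_apply_mult: "endo_apply (A * B) y = endo_apply A (endo_apply B y)"
  by transfer simp

lemma endo_apply_power: "endo_apply (A ^ n) y = (endo_apply A ^^ n) y"
  by (induction n) (simp_all add: endo_apply_mult)

lemma endo_apply_scaleR: "endo_apply (r *\<^sub>R A) y = r *\<^sub>R endo_apply A y"
  by transfer (simp add: blinfun.scaleR_left)

lemma ex_endo: "linear f \<Longrightarrow> \<exists>A. endo_apply A = f"
  for f :: "'a::euclidean_space \<Rightarrow> 'a"
  by (rule exI[of _ "Endo (Blinfun f)"])
    (simp add: endo_apply.rep_eq Endo_inverse bounded_linear_Blinfun_apply linear_conv_bounded_linear)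

lemma exp_endo_sums: "(\<lambda>n. (endo_apply A ^^ n) y /\<^sub>R fact n) sums endo_apply (exp A) y"
proof -
  have "(\<lambda>n. endo_apply (A ^ n /\<^sub>R fact n) y) sums endo_apply (exp A) y"
    by (rule bounded_linear.sums[OF bounded_linear_endo_apply_left exp_converges])
  then show ?thesis
    by (simp add: endo_apply_scaleR endo_apply_power)
qed

section \<open>The exponential of the adjoint representation\<close>

text \<open>Brackets are meaningful on a subspace only; composing with a linear retraction onto the subspace
turns them into endomorphisms of the whole space.\<close>

lemma ex_endo_on:
  fixes W :: "'a::euclidean_space set"
  assumes "subspace W" and "\<And>x y. \<lbrakk>x \<in> W; y \<in> W\<rbrakk> \<Longrightarrow> f (x + y) = f x + f y"
    and "\<And>c x. x \<in> W \<Longrightarrow> f (c *\<^sub>R x) = c *\<^sub>R f x"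
  shows "\<exists>A. \<forall>y\<in>W. endo_apply A y = f y"
proof -
  obtain P where P: "range P \<subseteq> W" "linear P" "\<forall>v\<in>W. P v = v"
    using linear_exists_left_inverse_on[of id W] assms(1) linear_id by auto
  have "linear (\<lambda>y. f (P y))"
    using P assms(2,3) by (intro linearI) (auto simp: linear_add linear_scale image_subset_iff)
  then obtain A where "endo_apply A = (\<lambda>y. f (P y))"
    using ex_endo by blast
  then show ?thesis
    using P(3) by (intro exI[of _ A]) simp
qed

lemma funpow_cong_on:
  assumes "\<And>w. w \<in> W \<Longrightarrow> f w \<in> W" and "\<And>w. w \<in> W \<Longrightarrow> g w = f w" and "y \<in> W"
  shows "(g ^^ n) y = (f ^^ n) y \<and> (f ^^ n) y \<in> W"
  by (induction n) (use assms in auto)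

text \<open>The value of the exponential at \<open>y\<close> depends only on the action on an invariant set that
contains \<open>y\<close>. This is how exponentials in different Lie algebras get compared.\<close>

lemma exp_ad_cong:
  assumes "W \<subseteq> \<gg>" "W \<subseteq> \<hh>" and "\<And>w. w \<in> W \<Longrightarrow> br x w \<in> W"
    and "\<And>w. w \<in> W \<Longrightarrow> br' x' w = br x w" and "y \<in> W"
  shows "exp_ad \<hh> br' x' y = exp_ad \<gg> br x y"
proof -
  have "(br' x' ^^ n) y = (br x ^^ n) y" for n
    using funpow_cong_on[of W "br x" "br' x'" y n] assms by blast
  then show ?thesis
    using assms by (auto simp: exp_ad_def)
qed

text \<open>One endomorphism \<open>A\<close> represents \<open>ad (t x)\<close> for all \<open>t\<close> at once, as \<open>t A\<close>, which is what
differentiation in \<open>t\<close> requires.\<close>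

lemma exp_ad_endo:
  fixes \<gg> :: "'a::euclidean_space set"
  assumes "lie_algebra \<gg> br" "x \<in> \<gg>"
  obtains A where "\<And>y. y \<in> \<gg> \<Longrightarrow> endo_apply A y = br x y"
    and "\<And>t y. y \<in> \<gg> \<Longrightarrow>
      (\<lambda>n. (br (t *\<^sub>R x) ^^ n) y /\<^sub>R fact n) sums endo_apply (exp (t *\<^sub>R A)) y"
    and "\<And>t y. y \<in> \<gg> \<Longrightarrow> exp_ad \<gg> br (t *\<^sub>R x) y = endo_apply (exp (t *\<^sub>R A)) y"
proof -
  interpret lie_algebra \<gg> br by fact
  obtain A where A: "\<And>y. y \<in> \<gg> \<Longrightarrow> endo_apply A y = br x y"
    using ex_endo_on[OF subspace, of "br x"] br_add_right br_scale_right assms(2) by blast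
  have sums: "(\<lambda>n. (br (t *\<^sub>R x) ^^ n) y /\<^sub>R fact n) sums endo_apply (exp (t *\<^sub>R A)) y" if "y \<in> \<gg>" for t y
  proof -
    have tx: "t *\<^sub>R x \<in> \<gg>"
      using subspace assms(2) by (rule subspace_scale)
    have "(endo_apply (t *\<^sub>R A) ^^ n) y = (br (t *\<^sub>R x) ^^ n) y" for n
      using funpow_cong_on[of \<gg> "br (t *\<^sub>R x)" "endo_apply (t *\<^sub>R A)" y n] that
        br_closed[OF tx] br_scale_left[OF assms(2)] A by (simp add: endo_apply_scaleR)
    then show ?thesis
      using exp_endo_sums[of "t *\<^sub>R A" y] by simp
  qed
  then have "exp_ad \<gg> br (t *\<^sub>R x) y = endo_apply (exp (t *\<^sub>R A)) y" if "y \<in> \<gg>" for t y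
    using sums[OF that, THEN sums_unique] that by (simp add: exp_ad_def)
  with A sums show thesis
    using that by blast
qed

lemma exp_ad_sums:
  fixes \<gg> :: "'a::euclidean_space set"
  assumes "lie_algebra \<gg> br" "x \<in> \<gg>" "y \<in> \<gg>"
  shows "(\<lambda>n. (br x ^^ n) y /\<^sub>R fact n) sums exp_ad \<gg> br x y"
proof -
  obtain A where "\<And>t y. y \<in> \<gg> \<Longrightarrow>
      (\<lambda>n. (br (t *\<^sub>R x) ^^ n) y /\<^sub>R fact n) sums endo_apply (exp (t *\<^sub>R A)) y"
    and "\<And>t y. y \<in> \<gg> \<Longrightarrow> exp_ad \<gg> br (t *\<^sub>R x) y = endo_apply (exp (t *\<^sub>R A)) y"
    using exp_ad_endo[OF assms(1,2)] by metis
  from this(1)[of y 1] this(2)[of y 1] show ?thesis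
    using assms by simp
qed

text \<open>The partial sums of the series lie in \<open>W\<close>, and subspaces of a Euclidean space are closed.\<close>

lemma exp_ad_closed:
  fixes \<gg> :: "'a::euclidean_space set"
  assumes "lie_algebra \<gg> br" "x \<in> \<gg>" "subspace W" "W \<subseteq> \<gg>"
    and "\<And>w. w \<in> W \<Longrightarrow> br x w \<in> W" and "y \<in> W"
  shows "exp_ad \<gg> br x y \<in> W"
proof -
  have "(\<lambda>n. \<Sum>k<n. (br x ^^ k) y /\<^sub>R fact k) \<longlonglongrightarrow> exp_ad \<gg> br x y"
    using exp_ad_sums[OF assms(1,2), of y] assms(4,6) by (auto simp: sums_def)
  moreover have "(br x ^^ k) y \<in> W" for k
    using funpow_cong_on[of W "br x" "br x" y k] assms by blast
  then have "(\<Sum>k<n. (br x ^^ k) y /\<^sub>R fact k) \<in> W" for n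
    using assms(3) by (intro subspace_sum subspace_scale) auto
  ultimately show ?thesis
    by (rule closed_sequentially[OF closed_subspace[OF assms(3)], rotated])
qed

lemma exp_ad_in:
  fixes \<gg> :: "'a::euclidean_space set"
  assumes "lie_algebra \<gg> br" "x \<in> \<gg>" "y \<in> \<gg>"
  shows "exp_ad \<gg> br x y \<in> \<gg>"
  using exp_ad_closed[OF assms(1,2), of \<gg>] assms
  by (auto intro: lie_algebra.subspace lie_algebra.br_closed)

lemma exp_ad_extensional: "exp_ad \<gg> br x \<in> extensional \<gg>"
  by (simp add: exp_ad_def)

lemma exp_ad_linear:
  fixes \<gg> :: "'a::euclidean_space set"
  assumes "lie_algebra \<gg> br" "x \<in> \<gg>" "u \<in> \<gg>" "v \<in> \<gg>"
  shows "exp_ad \<gg> br x (u + v) = exp_ad \<gg> br x u + exp_ad \<gg> br x v"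
    and "exp_ad \<gg> br x (c *\<^sub>R u) = c *\<^sub>R exp_ad \<gg> br x u"
proof -
  obtain A where A: "\<And>t y. y \<in> \<gg> \<Longrightarrow> exp_ad \<gg> br (t *\<^sub>R x) y = endo_apply (exp (t *\<^sub>R A)) y"
    using exp_ad_endo[OF assms(1,2)] by metis
  have in_g: "u + v \<in> \<gg>" "c *\<^sub>R u \<in> \<gg>"
    using lie_algebra.subspace[OF assms(1)] assms(3,4) by (auto intro: subspace_add subspace_scale)
  from A[of _ 1] in_g assms(3,4)
  show "exp_ad \<gg> br x (u + v) = exp_ad \<gg> br x u + exp_ad \<gg> br x v"
    "exp_ad \<gg> br x (c *\<^sub>R u) = c *\<^sub>R exp_ad \<gg> br x u"
    by (auto simp: linear_add[OF linear_endo_apply] linear_scale[OF linear_endo_apply])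
qed

lemma exp_ad_minus:
  fixes \<gg> :: "'a::euclidean_space set"
  assumes "lie_algebra \<gg> br" "x \<in> \<gg>" "y \<in> \<gg>"
  shows "exp_ad \<gg> br (- x) (exp_ad \<gg> br x y) = y"
proof -
  obtain A where A: "\<And>t y. y \<in> \<gg> \<Longrightarrow> exp_ad \<gg> br (t *\<^sub>R x) y = endo_apply (exp (t *\<^sub>R A)) y"
    using exp_ad_endo[OF assms(1,2)] by metis
  have "exp_ad \<gg> br (- x) (exp_ad \<gg> br x y) = endo_apply (exp (- A)) (endo_apply (exp A) y)"
    using A[of y 1] A[of "exp_ad \<gg> br x y" "-1"] exp_ad_in[OF assms] assms(3) by simp
  also have "\<dots> = endo_apply (exp (- A) * exp A) y"
    by (simp add: endo_apply_mult)
  also have "exp (- A) * exp A = 1"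
    using exp_minus_inverse[of "- A"] by simp
  finally show ?thesis
    by simp
qed

lemma exp_ad_has_vector_derivative:
  fixes \<gg> :: "'a::euclidean_space set"
  assumes "lie_algebra \<gg> br" "x \<in> \<gg>" "y \<in> \<gg>"
  shows "((\<lambda>t. exp_ad \<gg> br (t *\<^sub>R x) y) has_vector_derivative br x y) (at 0)"
proof -
  obtain A where A: "\<And>y. y \<in> \<gg> \<Longrightarrow> endo_apply A y = br x y"
    "\<And>t y. y \<in> \<gg> \<Longrightarrow> exp_ad \<gg> br (t *\<^sub>R x) y = endo_apply (exp (t *\<^sub>R A)) y"
    using exp_ad_endo[OF assms(1,2)] by metis
  have "((\<lambda>t. exp (t *\<^sub>R A)) has_vector_derivative exp (0 *\<^sub>R A) * A) (at 0)"
    by (rule exp_scaleR_has_vector_derivative_right)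
  then have "((\<lambda>t. endo_apply (exp (t *\<^sub>R A)) y) has_vector_derivative endo_apply (exp (0 *\<^sub>R A) * A) y) (at 0)"
    by (rule bounded_linear.has_vector_derivative[OF bounded_linear_endo_apply_left])
  then show ?thesis
    using A assms(3) by simp
qed

section \<open>Groups generated by exponentials\<close>

lemma Bij_inverse_pair:
  assumes "f \<in> extensional S" "h \<in> extensional S" "f \<in> S \<rightarrow> S" "h \<in> S \<rightarrow> S"
    and "\<And>y. y \<in> S \<Longrightarrow> h (f y) = y" "\<And>y. y \<in> S \<Longrightarrow> f (h y) = y"
  shows "f \<in> Bij S" and "inv\<^bsub>BijGroup S\<^esub> f = h"
proof -
  have "bij_betw f S S" "bij_betw h S S"
    using assms(3-6) by (auto intro!: bij_betw_byWitness[of S h f] bij_betw_byWitness[of S f h])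
  then have Bij: "f \<in> Bij S" "h \<in> Bij S"
    using assms by (auto simp: Bij_def)
  then show "f \<in> Bij S" by simp
  have "compose S h f = (\<lambda>y\<in>S. y)"
    using assms(5) by (auto simp: compose_def)
  then show "inv\<^bsub>BijGroup S\<^esub> f = h"
    using Bij by (intro group.inv_equality[OF group_BijGroup]) (auto simp: BijGroup_def)
qed

text \<open>The exponentials of \<open>\<kk>\<close> are bijections, and the set of them is closed under inverses. Then the
group that they generate consists of products of exponentials, and inductions over it need no
separate case for inverses. Internal Lie algebras and external direct sums both satisfy this.\<close>

definition symmetric_exps ::
  "'a::real_normed_vector set \<Rightarrow> ('a \<Rightarrow> 'a \<Rightarrow> 'a) \<Rightarrow> 'a set \<Rightarrow> bool" where
  "symmetric_exps \<gg> br \<kk> \<longleftrightarrow> (\<forall>x\<in>\<kk>. - x \<in> \<kk> \<and> exp_ad \<gg> br x \<in> Bij \<gg> \<and>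
     inv\<^bsub>BijGroup \<gg>\<^esub> (exp_ad \<gg> br x) = exp_ad \<gg> br (- x))"

lemma symmetric_exps:
  fixes \<gg> :: "'a::euclidean_space set"
  assumes "lie_algebra \<gg> br" "subspace \<kk>" "\<kk> \<subseteq> \<gg>"
  shows "symmetric_exps \<gg> br \<kk>"
  unfolding symmetric_exps_def
proof (intro ballI)
  fix x assume "x \<in> \<kk>"
  then have x: "x \<in> \<gg>" "- x \<in> \<gg>" "- x \<in> \<kk>"
    using assms subspace_neg[of \<kk> x] by auto
  have "exp_ad \<gg> br x (exp_ad \<gg> br (- x) y) = y" if "y \<in> \<gg>" for y
    using exp_ad_minus[OF assms(1) x(2) that] by simp
  then show "- x \<in> \<kk> \<and> exp_ad \<gg> br x \<in> Bij \<gg> \<and>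
     inv\<^bsub>BijGroup \<gg>\<^esub> (exp_ad \<gg> br x) = exp_ad \<gg> br (- x)"
    using Bij_inverse_pair[of "exp_ad \<gg> br x" \<gg> "exp_ad \<gg> br (- x)"] x
      exp_ad_minus[OF assms(1) x(1)] exp_ad_in[OF assms(1)] exp_ad_extensional by blast
qed

lemma carrier_Int_group:
  "carrier (Int_group \<gg> br \<kk>) = generate (BijGroup \<gg>) {exp_ad \<gg> br x | x. x \<in> \<kk>}"
  by (simp add: Int_group_def)

lemma Int_group_Bij:
  assumes "symmetric_exps \<gg> br \<kk>"
  shows "carrier (Int_group \<gg> br \<kk>) \<subseteq> Bij \<gg>"
  using group.generate_in_carrier[OF group_BijGroup, of "{exp_ad \<gg> br x | x. x \<in> \<kk>}" \<gg>] assms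
  by (auto simp: carrier_Int_group symmetric_exps_def BijGroup_def)

lemma Int_group_id: "(\<lambda>y\<in>\<gg>. y) \<in> carrier (Int_group \<gg> br \<kk>)"
  using generate.one[of "BijGroup \<gg>"] by (simp add: carrier_Int_group BijGroup_def)

lemma Int_group_exp: "x \<in> \<kk> \<Longrightarrow> exp_ad \<gg> br x \<in> carrier (Int_group \<gg> br \<kk>)"
  by (auto simp: carrier_Int_group intro: generate.incl)

lemma Int_group_compose:
  assumes "symmetric_exps \<gg> br \<kk>"
    and "\<phi> \<in> carrier (Int_group \<gg> br \<kk>)" "\<psi> \<in> carrier (Int_group \<gg> br \<kk>)"
  shows "compose \<gg> \<phi> \<psi> \<in> carrier (Int_group \<gg> br \<kk>)"
proof -
  have "\<phi> \<in> Bij \<gg>" "\<psi> \<in> Bij \<gg>"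
    using Int_group_Bij[OF assms(1)] assms(2,3) by auto
  then have "\<phi> \<otimes>\<^bsub>BijGroup \<gg>\<^esub> \<psi> = compose \<gg> \<phi> \<psi>"
    by (simp add: BijGroup_def)
  then show ?thesis
    using generate.eng[OF assms(2,3)[unfolded carrier_Int_group]] by (simp add: carrier_Int_group)
qed

lemma Int_group_induct [consumes 2, case_names id exp compose]:
  assumes "symmetric_exps \<gg> br \<kk>" and "\<phi> \<in> carrier (Int_group \<gg> br \<kk>)"
    and id: "P (\<lambda>y\<in>\<gg>. y)" and exp: "\<And>x. x \<in> \<kk> \<Longrightarrow> P (exp_ad \<gg> br x)"
    and compose: "\<And>\<phi> \<psi>. \<lbrakk>\<phi> \<in> carrier (Int_group \<gg> br \<kk>); \<psi> \<in> carrier (Int_group \<gg> br \<kk>);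
      P \<phi>; P \<psi>\<rbrakk> \<Longrightarrow> P (compose \<gg> \<phi> \<psi>)"
  shows "P \<phi>"
  using assms(2) unfolding carrier_Int_group
proof (induction rule: generate.induct)
  case one
  have "\<one>\<^bsub>BijGroup \<gg>\<^esub> = (\<lambda>y\<in>\<gg>. y)"
    by (simp only: BijGroup_def monoid.simps)
  then show ?case using id by (simp only:)
next
  case (incl h)
  then show ?case using exp by auto
next
  case (inv h)
  then show ?case using exp assms(1) by (auto simp: symmetric_exps_def)
next
  case (eng h1 h2)
  then have "h1 \<in> Bij \<gg>" "h2 \<in> Bij \<gg>"
    using Int_group_Bij[OF assms(1)] by (auto simp: carrier_Int_group)
  then have "h1 \<otimes>\<^bsub>BijGroup \<gg>\<^esub> h2 = compose \<gg> h1 h2"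
    by (simp add: BijGroup_def)
  then show ?case
    using compose[of h1 h2] eng by (simp add: carrier_Int_group)
qed

lemma Int_group_inverse:
  assumes "symmetric_exps \<gg> br \<kk>" and "\<phi> \<in> carrier (Int_group \<gg> br \<kk>)"
  shows "\<exists>\<psi>\<in>carrier (Int_group \<gg> br \<kk>). \<forall>y\<in>\<gg>. \<psi> (\<phi> y) = y \<and> \<phi> (\<psi> y) = y"
proof -
  have Bij: "\<phi> \<in> Bij \<gg>"
    using assms Int_group_Bij by blast
  let ?\<psi> = "inv\<^bsub>BijGroup \<gg>\<^esub> \<phi>"
  have \<psi>: "?\<psi> \<in> carrier (Int_group \<gg> br \<kk>)"
    using group.generate_m_inv_closed[OF group_BijGroup, of "{exp_ad \<gg> br x | x. x \<in> \<kk>}" \<gg> \<phi>] assms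
    by (auto simp: carrier_Int_group symmetric_exps_def BijGroup_def)
  then have Bij': "?\<psi> \<in> Bij \<gg>"
    using assms(1) Int_group_Bij by blast
  have "compose \<gg> ?\<psi> \<phi> = (\<lambda>y\<in>\<gg>. y)" "compose \<gg> \<phi> ?\<psi> = (\<lambda>y\<in>\<gg>. y)"
    using group.l_inv[OF group_BijGroup, of \<phi> \<gg>] group.r_inv[OF group_BijGroup, of \<phi> \<gg>] Bij Bij'
    by (auto simp: BijGroup_def)
  then have "\<forall>y\<in>\<gg>. ?\<psi> (\<phi> y) = y \<and> \<phi> (?\<psi> y) = y"
    by (metis compose_eq restrict_apply')
  then show ?thesis
    using \<psi> by blast
qed

text \<open>A relation that matches generators of one group with generators of another and is compatible with
products matches all elements.\<close>

lemma Int_group_related: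
  assumes "symmetric_exps \<gg> br \<kk>" and "symmetric_exps \<hh> br' \<kk>'"
    and "\<phi> \<in> carrier (Int_group \<gg> br \<kk>)"
    and id: "R (\<lambda>y\<in>\<gg>. y) (\<lambda>y\<in>\<hh>. y)"
    and exp: "\<And>x. x \<in> \<kk> \<Longrightarrow> \<exists>x'\<in>\<kk>'. R (exp_ad \<gg> br x) (exp_ad \<hh> br' x')"
    and compose: "\<And>\<phi> \<phi>' \<psi> \<psi>'. \<lbrakk>\<phi> \<in> carrier (Int_group \<gg> br \<kk>); \<phi>' \<in> carrier (Int_group \<gg> br \<kk>);
       \<psi> \<in> carrier (Int_group \<hh> br' \<kk>'); \<psi>' \<in> carrier (Int_group \<hh> br' \<kk>');
       R \<phi> \<psi>; R \<phi>' \<psi>'\<rbrakk> \<Longrightarrow> R (compose \<gg> \<phi> \<phi>') (compose \<hh> \<psi> \<psi>')"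
  shows "\<exists>\<psi>\<in>carrier (Int_group \<hh> br' \<kk>'). R \<phi> \<psi>"
  using assms(1,3)
proof (induction rule: Int_group_induct)
  case id
  then show ?case using assms(4) Int_group_id by blast
next
  case (exp x)
  then show ?case using assms(5) Int_group_exp by blast
next
  case (compose \<phi>1 \<phi>2)
  then show ?case using assms(6) Int_group_compose[OF assms(2)] by blast
qed

lemma Int_group_linear:
  fixes \<gg> :: "'a::euclidean_space set"
  assumes "lie_algebra \<gg> br" "subspace \<kk>" "\<kk> \<subseteq> \<gg>" and "\<phi> \<in> carrier (Int_group \<gg> br \<kk>)"
  shows "(\<forall>y\<in>\<gg>. \<phi> y \<in> \<gg>) \<and> (\<forall>y\<in>\<gg>. \<forall>z\<in>\<gg>. \<phi> (y + z) = \<phi> y + \<phi> z) \<and>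
    (\<forall>y\<in>\<gg>. \<forall>c. \<phi> (c *\<^sub>R y) = c *\<^sub>R \<phi> y)"
  using symmetric_exps[OF assms(1-3)] assms(4)
proof (induction rule: Int_group_induct)
  case id
  then show ?case
    using lie_algebra.subspace[OF assms(1)] by (auto simp: subspace_add subspace_scale)
next
  case (exp x)
  then show ?case
    using exp_ad_in[OF assms(1), of x] exp_ad_linear[OF assms(1), of x] assms(3)
    by (simp add: subset_iff)
next
  case (compose \<phi> \<psi>)
  then show ?case
    using lie_algebra.subspace[OF assms(1)] by (auto simp: compose_def subspace_add subspace_scale)
qed

section \<open>Symmetric bilinear forms on subspaces\<close>

text \<open>Forms are considered on a subspace because Lie algebras and their \<open>\<plusminus>1\<close> eigenspaces are such, and
without reference to the ambient inner product because the relevant ones are \<open>q\<close> and \<open>B\<close>.\<close>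

locale symmetric_bilinear_on =
  fixes V :: "'a::euclidean_space set" and b :: "'a \<Rightarrow> 'a \<Rightarrow> real"
  assumes subspace_V: "subspace V"
    and add_left: "\<lbrakk>u \<in> V; v \<in> V; w \<in> V\<rbrakk> \<Longrightarrow> b (u + v) w = b u w + b v w"
    and scale_left: "\<lbrakk>u \<in> V; v \<in> V\<rbrakk> \<Longrightarrow> b (c *\<^sub>R u) v = c * b u v"
    and sym: "\<lbrakk>u \<in> V; v \<in> V\<rbrakk> \<Longrightarrow> b u v = b v u"
begin

lemma add_right: "\<lbrakk>u \<in> V; v \<in> V; w \<in> V\<rbrakk> \<Longrightarrow> b w (u + v) = b w u + b w v"
  using add_left sym subspace_add[OF subspace_V] by metis

lemma scale_right: "\<lbrakk>u \<in> V; v \<in> V\<rbrakk> \<Longrightarrow> b v (c *\<^sub>R u) = c * b v u"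
  using scale_left sym subspace_scale[OF subspace_V] by metis

lemma minus_left: "\<lbrakk>u \<in> V; v \<in> V\<rbrakk> \<Longrightarrow> b (- u) v = - b u v"
  using scale_left[of u v "-1"] by simp

lemma minus_right: "\<lbrakk>u \<in> V; v \<in> V\<rbrakk> \<Longrightarrow> b v (- u) = - b v u"
  using scale_right[of u v "-1"] by simp

lemma diff_left: "\<lbrakk>u \<in> V; v \<in> V; w \<in> V\<rbrakk> \<Longrightarrow> b (u - v) w = b u w - b v w"
  using add_left[of u "- v" w] minus_left[of v w] subspace_neg[OF subspace_V] by simp

lemma zero_left: "v \<in> V \<Longrightarrow> b 0 v = 0"
  using scale_left[of v v 0] by simp

lemma zero_right: "v \<in> V \<Longrightarrow> b v 0 = 0"
  using scale_right[of v v 0] by simp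

lemma sum_left:
  assumes "finite I" "\<And>i. i \<in> I \<Longrightarrow> u i \<in> V" "v \<in> V"
  shows "b (\<Sum>i\<in>I. c i *\<^sub>R u i) v = (\<Sum>i\<in>I. c i * b (u i) v)"
  using assms(1,2)
proof (induction rule: finite_induct)
  case empty
  then show ?case using zero_left[OF assms(3)] by simp
next
  case (insert i I)
  have "(\<Sum>j\<in>I. c j *\<^sub>R u j) \<in> V"
    using insert by (intro subspace_sum subspace_scale subspace_V) auto
  then show ?case
    using insert assms(3) by (simp add: add_left scale_left subspace_scale[OF subspace_V])
qed

lemma sum_right:
  assumes "finite I" "\<And>i. i \<in> I \<Longrightarrow> u i \<in> V" "v \<in> V"
  shows "b v (\<Sum>i\<in>I. c i *\<^sub>R u i) = (\<Sum>i\<in>I. c i * b v (u i))"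
proof -
  have "(\<Sum>j\<in>I. c j *\<^sub>R u j) \<in> V"
    using assms by (intro subspace_sum subspace_scale subspace_V) auto
  then have "b v (\<Sum>i\<in>I. c i *\<^sub>R u i) = b (\<Sum>i\<in>I. c i *\<^sub>R u i) v"
    by (rule sym[OF assms(3)])
  also have "\<dots> = (\<Sum>i\<in>I. c i * b (u i) v)"
    using assms by (rule sum_left)
  also have "\<dots> = (\<Sum>i\<in>I. c i * b v (u i))"
    using assms sym by (intro sum.cong) auto
  finally show ?thesis .
qed

lemma zero_on_span:
  assumes "span S = V" and S: "\<And>s t. \<lbrakk>s \<in> S; t \<in> S\<rbrakk> \<Longrightarrow> b s t = 0"
    and "u \<in> V" "v \<in> V"
  shows "b u v = 0"
proof -
  have SV: "S \<subseteq> V"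
    using assms(1) span_superset by blast
  have half: "b w t = 0" if "w \<in> V" and t: "t \<in> V" "\<And>s. s \<in> S \<Longrightarrow> b s t = 0" for w t
  proof -
    have "w \<in> span S" using that assms(1) by simp
    then have "w \<in> V \<and> b w t = 0"
    proof (induction rule: span_induct_alt)
      case base
      then show ?case using t zero_left subspace_0[OF subspace_V] by simp
    next
      case (step c x y)
      then show ?case
        using t SV add_left scale_left subspace_add[OF subspace_V] subspace_scale[OF subspace_V]
        by (auto simp: subset_iff)
    qed
    then show ?thesis by simp
  qed
  have "b s v = 0" if "s \<in> S" for s
    using half[of v s] assms(4) SV S that sym by (auto simp: subset_iff)
  then show ?thesis
    using half[of u v] assms(3,4) by blast
qed

end

locale inner_product_on = symmetric_bilinear_on +
  assumes pos: "\<lbrakk>u \<in> V; u \<noteq> 0\<rbrakk> \<Longrightarrow> b u u > 0"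
begin

lemma eq_zero_iff: "u \<in> V \<Longrightarrow> b u u = 0 \<longleftrightarrow> u = 0"
  using pos zero_left by force

lemma nonneg: "u \<in> V \<Longrightarrow> b u u \<ge> 0"
  using pos[of u] eq_zero_iff[of u] by (cases "u = 0") auto

lemma orthogonal_residue:
  assumes "finite E" "E \<subseteq> V" "\<And>e e'. \<lbrakk>e \<in> E; e' \<in> E\<rbrakk> \<Longrightarrow> b e e' = (if e = e' then 1 else 0)"
    and "x \<in> V" and "w \<in> span E"
  shows "b (x - (\<Sum>e\<in>E. b x e *\<^sub>R e)) w = 0"
proof -
  have u: "(\<Sum>e\<in>E. b x e *\<^sub>R e) \<in> V"
    using assms(2) by (intro subspace_sum subspace_scale subspace_V) auto
  have E: "b (x - (\<Sum>e\<in>E. b x e *\<^sub>R e)) e' = 0" if "e' \<in> E" for e'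
  proof -
    have "b (\<Sum>e\<in>E. b x e *\<^sub>R e) e' = (\<Sum>e\<in>E. b x e * b e e')"
      using assms that by (intro sum_left) auto
    also have "\<dots> = (\<Sum>e\<in>E. if e = e' then b x e else 0)"
      using assms(3) that by (intro sum.cong) auto
    also have "\<dots> = b x e'"
      using assms(1) that by simp
    finally show ?thesis
      using u assms(2,4) that by (auto simp: diff_left)
  qed
  have diff: "x - (\<Sum>e\<in>E. b x e *\<^sub>R e) \<in> V"
    using u assms(4) subspace_diff[OF subspace_V] by blast
  from assms(5) have "w \<in> V \<and> b (x - (\<Sum>e\<in>E. b x e *\<^sub>R e)) w = 0"
  proof (induction rule: span_induct_alt)
    case base
    then show ?case using diff zero_right subspace_0[OF subspace_V] by simp
  next
    case (step c y z)
    then show ?case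
      using E assms(2) diff add_right scale_right subspace_add[OF subspace_V]
        subspace_scale[OF subspace_V] by (auto simp: subset_iff)
  qed
  then show ?thesis by simp
qed

lemma Gram_Schmidt:
  assumes "finite S" "S \<subseteq> V"
  shows "\<exists>E. finite E \<and> span E = span S \<and>
    (\<forall>e\<in>E. \<forall>e'\<in>E. b e e' = (if e = e' then 1 else 0))"
  using assms
proof (induction rule: finite_induct)
  case empty
  then show ?case by (intro exI[of _ "{}"]) simp
next
  case (insert a S)
  then obtain E where E: "finite E" "span E = span S"
    "\<And>e e'. \<lbrakk>e \<in> E; e' \<in> E\<rbrakk> \<Longrightarrow> b e e' = (if e = e' then 1 else 0)"
    by auto
  have a: "a \<in> V" and "span S \<subseteq> V"
    using insert by (simp_all add: span_minimal subspace_V)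
  then have EV: "E \<subseteq> V"
    using E(2) span_superset by blast
  define r where "r = a - (\<Sum>e\<in>E. b a e *\<^sub>R e)"
  have "a - r \<in> span E"
    by (auto simp: r_def intro!: span_sum span_scale intro: span_base)
  then have span_r: "span (insert a E) = span (insert r E)"
    by (rule eq_span_insert_eq)
  have span_a: "span (insert a E) = span (insert a S)"
    using E(2) by (simp add: span_insert)
  have rV: "r \<in> V"
    using a EV by (auto simp: r_def intro!: subspace_diff subspace_sum subspace_scale subspace_V)
  have r_orth: "b r e = 0" if "e \<in> E" for e
    unfolding r_def using orthogonal_residue[OF E(1) EV E(3) a] that span_base by blast
  show ?case
  proof (cases "r = 0")
    case True
    then have "span E = span (insert a S)"
      using span_r span_a by (simp add: span_insert_0)
    then show ?thesis
      using E by blast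
  next
    case False
    define n where "n = inverse (sqrt (b r r))"
    have n: "n > 0" "n * n * b r r = 1"
      using pos[OF rV False] by (auto simp: n_def field_simps)
    have nr: "b (n *\<^sub>R r) (n *\<^sub>R r) = 1"
      using rV n by (simp add: scale_left scale_right subspace_scale[OF subspace_V])
    have orth: "b (n *\<^sub>R r) e = 0" "b e (n *\<^sub>R r) = 0" if "e \<in> E" for e
      using r_orth[OF that] rV that EV sym[of e r]
      by (auto simp: scale_left scale_right subset_iff)
    have "r \<in> span (insert (n *\<^sub>R r) E)"
      using span_scale[OF span_base[of "n *\<^sub>R r" "insert (n *\<^sub>R r) E"], of "inverse n"] n by simp
    moreover have "n *\<^sub>R r \<in> span (insert r E)"
      by (intro span_scale span_base) simp
    ultimately have "span (insert (n *\<^sub>R r) E) = span (insert r E)"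
      by (intro span_eq[THEN iffD2] conjI) (auto intro: span_base)
    then have "span (insert (n *\<^sub>R r) E) = span (insert a S)"
      using span_r span_a by simp
    moreover have "\<forall>e\<in>insert (n *\<^sub>R r) E. \<forall>e'\<in>insert (n *\<^sub>R r) E.
        b e e' = (if e = e' then 1 else 0)"
      using nr orth E(3) by force
    ultimately show ?thesis
      using E(1) by blast
  qed
qed

lemma ex_orthonormal_basis:
  assumes "subspace U" "U \<subseteq> V"
  obtains E where "finite E" "span E = U"
    "\<And>e e'. \<lbrakk>e \<in> E; e' \<in> E\<rbrakk> \<Longrightarrow> b e e' = (if e = e' then 1 else 0)"
proof -
  obtain S where "S \<subseteq> U" "independent S" "U \<subseteq> span S"
    using basis_exists by metis
  then have "finite S" "span S = U" "S \<subseteq> V"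
    using assms independent_imp_finite by (auto simp: span_minimal subset_antisym)
  then show thesis
    using Gram_Schmidt[of S] that by metis
qed

lemma orthogonal_projection:
  assumes "subspace U" "U \<subseteq> V" "x \<in> V"
  obtains u where "u \<in> U" "\<And>w. w \<in> U \<Longrightarrow> b (x - u) w = 0"
proof -
  obtain E where E: "finite E" "span E = U"
    "\<And>e e'. \<lbrakk>e \<in> E; e' \<in> E\<rbrakk> \<Longrightarrow> b e e' = (if e = e' then 1 else 0)"
    using ex_orthonormal_basis[OF assms(1,2)] by blast
  have "E \<subseteq> V"
    using E(2) assms(2) span_superset by blast
  then have "\<And>w. w \<in> U \<Longrightarrow> b (x - (\<Sum>e\<in>E. b x e *\<^sub>R e)) w = 0"
    using orthogonal_residue[OF E(1) _ E(3) assms(3)] E(2) by blast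
  moreover have "(\<Sum>e\<in>E. b x e *\<^sub>R e) \<in> U"
    unfolding E(2)[symmetric] by (auto intro!: span_sum span_scale intro: span_base)
  ultimately show thesis
    using that by blast
qed

lemma orthonormal_expansion:
  assumes "finite E" "span E = V" "\<And>e e'. \<lbrakk>e \<in> E; e' \<in> E\<rbrakk> \<Longrightarrow> b e e' = (if e = e' then 1 else 0)"
    and "x \<in> V"
  shows "(\<Sum>e\<in>E. b x e *\<^sub>R e) = x"
proof -
  have E: "E \<subseteq> V"
    using assms(2) span_superset by blast
  let ?r = "x - (\<Sum>e\<in>E. b x e *\<^sub>R e)"
  have r: "?r \<in> V"
    using assms(4) E by (auto intro!: subspace_diff subspace_sum subspace_scale subspace_V)
  then have "b ?r ?r = 0"
    using orthogonal_residue[OF assms(1) E assms(3,4), of ?r] assms(2) by auto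
  then show ?thesis
    using eq_zero_iff[OF r] by simp
qed

end

lemma inner_product_on_inner: "subspace V \<Longrightarrow> inner_product_on V (\<bullet>)"
  by unfold_locales (auto simp: inner_add_left intro: inner_commute)

lemma (in symmetric_bilinear_on) continuous_on_form:
  assumes "\<And>k. k \<in> K \<Longrightarrow> f k \<in> V" "\<And>k. k \<in> K \<Longrightarrow> g k \<in> V"
    and "continuous_on K f" "continuous_on K g"
  shows "continuous_on K (\<lambda>k. b (f k) (g k))"
proof -
  interpret I: inner_product_on V "(\<bullet>)"
    by (rule inner_product_on_inner[OF subspace_V])
  obtain E where E: "finite E" "span E = V"
    "\<And>e e'. \<lbrakk>e \<in> E; e' \<in> E\<rbrakk> \<Longrightarrow> e \<bullet> e' = (if e = e' then 1 else 0)"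
    using I.ex_orthonormal_basis[OF subspace_V] by blast
  have EV: "E \<subseteq> V"
    using E(2) span_superset by blast
  have "b u v = (\<Sum>e\<in>E. (u \<bullet> e) * (\<Sum>e'\<in>E. (v \<bullet> e') * b e e'))" if "u \<in> V" "v \<in> V" for u v
  proof -
    have "b u v = b (\<Sum>e\<in>E. (u \<bullet> e) *\<^sub>R e) v"
      using I.orthonormal_expansion[OF E that(1)] by simp
    also have "\<dots> = (\<Sum>e\<in>E. (u \<bullet> e) * b e v)"
      using EV that by (intro sum_left[OF E(1)]) auto
    also have "\<dots> = (\<Sum>e\<in>E. (u \<bullet> e) * (\<Sum>e'\<in>E. (v \<bullet> e') * b e e'))"
    proof (intro sum.cong refl)
      fix e assume "e \<in> E"
      then have "b e v = b e (\<Sum>e'\<in>E. (v \<bullet> e') *\<^sub>R e')"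
        using I.orthonormal_expansion[OF E that(2)] by simp
      also have "\<dots> = (\<Sum>e'\<in>E. (v \<bullet> e') * b e e')"
        using EV \<open>e \<in> E\<close> by (intro sum_right[OF E(1)]) auto
      finally show "(u \<bullet> e) * b e v = (u \<bullet> e) * (\<Sum>e'\<in>E. (v \<bullet> e') * b e e')"
        by simp
    qed
    finally show ?thesis .
  qed
  then show ?thesis
    using assms by (simp add: continuous_intros cong: continuous_on_cong)
qed

text \<open>The degenerate case of the Cauchy--Schwarz inequality: otherwise the quadratic polynomial
\<open>t \<mapsto> b (u + t w) (u + t w)\<close>, which has no constant term but a nonzero linear one, would take
negative values.\<close>

lemma (in symmetric_bilinear_on) psd_isotropic_radical:
  assumes psd: "\<And>u. u \<in> V \<Longrightarrow> b u u \<ge> 0" and u: "u \<in> V" "b u u = 0" and w: "w \<in> V"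
  shows "b u w = 0"
proof (rule ccontr)
  assume neq: "b u w \<noteq> 0"
  define c where "c = b w w + 1"
  have c: "c > 0"
    using psd[OF w] by (simp add: c_def)
  \<comment> \<open>The minimum is at \<open>- b u w / b w w\<close>; adding 1 to the denominator also covers \<open>b w w = 0\<close>.\<close>
  define t where "t = - b u w / c"
  have tw: "t *\<^sub>R w \<in> V"
    using w subspace_scale[OF subspace_V] by blast
  have "0 \<le> b (u + t *\<^sub>R w) (u + t *\<^sub>R w)"
    using psd u(1) tw subspace_add[OF subspace_V] by blast
  also have "\<dots> = 2 * t * b u w + t\<^sup>2 * b w w"
    using u w tw subspace_add[OF subspace_V]
    by (simp add: add_left add_right scale_left scale_right sym[of w u] power2_eq_square algebra_simps)
  also have "\<dots> = (b u w)\<^sup>2 * (- 2 * c + b w w) / c\<^sup>2"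
    using c by (simp add: t_def field_simps power2_eq_square)
  also have "\<dots> < 0"
    using neq c psd[OF w] by (auto simp: c_def intro!: divide_neg_pos mult_pos_neg)
  finally show False
    by simp
qed

lemma (in symmetric_bilinear_on) ex_inner_representation:
  assumes "w \<in> V"
  obtains c where "\<And>u. u \<in> V \<Longrightarrow> b u w = u \<bullet> c"
proof -
  interpret I: inner_product_on V "(\<bullet>)"
    by (rule inner_product_on_inner[OF subspace_V])
  obtain E where E: "finite E" "span E = V"
    "\<And>e e'. \<lbrakk>e \<in> E; e' \<in> E\<rbrakk> \<Longrightarrow> e \<bullet> e' = (if e = e' then 1 else 0)"
    using I.ex_orthonormal_basis[OF subspace_V] by blast
  have EV: "E \<subseteq> V"
    using E(2) span_superset by blast
  have "b u w = u \<bullet> (\<Sum>e\<in>E. b e w *\<^sub>R e)" if "u \<in> V" for u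
  proof -
    have "b u w = b (\<Sum>e\<in>E. (u \<bullet> e) *\<^sub>R e) w"
      using I.orthonormal_expansion[OF E that] by simp
    also have "\<dots> = (\<Sum>e\<in>E. (u \<bullet> e) * b e w)"
      using EV assms by (intro sum_left[OF E(1)]) auto
    also have "\<dots> = u \<bullet> (\<Sum>e\<in>E. b e w *\<^sub>R e)"
      by (simp add: inner_sum_right mult.commute)
    finally show ?thesis .
  qed
  then show thesis
    using that by blast
qed

section \<open>Invariant inner products of compact linear groups\<close>

text \<open>The elements of \<open>K\<close> are functions on the whole type of which only the restrictions to \<open>V\<close>
matter, and the group laws are required on \<open>V\<close> only.

An invariant inner product is found without integration over the group. The symmetric bilinear
forms between two invariant bounds form a convex set that is compact for pointwise convergence and
stable under \<open>K\<close>. On this set, the maximum over \<open>K\<close> of a Euclidean norm of the translated form is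
a \<open>K\<close>-invariant, lower semicontinuous and strictly convex function, so it has exactly one
minimum point; invariance of the function makes this point fixed by \<open>K\<close>.\<close>

locale compact_linear_group =
  fixes V :: "'a::euclidean_space set" and K :: "('a \<Rightarrow> 'a) set"
  assumes subspace_V: "subspace V" and compact_K: "compact K" and nonempty: "K \<noteq> {}"
    and maps: "\<lbrakk>k \<in> K; u \<in> V\<rbrakk> \<Longrightarrow> k u \<in> V"
    and map_add: "\<lbrakk>k \<in> K; u \<in> V; v \<in> V\<rbrakk> \<Longrightarrow> k (u + v) = k u + k v"
    and map_scale: "\<lbrakk>k \<in> K; u \<in> V\<rbrakk> \<Longrightarrow> k (c *\<^sub>R u) = c *\<^sub>R k u"
    and mult: "\<lbrakk>k \<in> K; h \<in> K\<rbrakk> \<Longrightarrow> \<exists>l\<in>K. \<forall>u\<in>V. l u = k (h u)"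
    and inverse: "k \<in> K \<Longrightarrow> \<exists>h\<in>K. \<forall>u\<in>V. h (k u) = u \<and> k (h u) = u"
begin

lemma continuous_on_eval: "continuous_on K (\<lambda>k. k u)"
  using continuous_on_product_coordinates by (rule continuous_on_subset) simp

text \<open>Right translation by \<open>h\<close> permutes \<open>K\<close>; this makes all quantities defined by extrema over \<open>K\<close>
invariant.\<close>

lemma orbit_shift:
  assumes "h \<in> K" "u \<in> V"
  shows "(\<lambda>k. k (h u)) ` K = (\<lambda>k. k u) ` K"
proof (intro equalityI subsetI)
  fix y assume "y \<in> (\<lambda>k. k (h u)) ` K"
  then obtain k where k: "k \<in> K" "y = k (h u)"
    by blast
  obtain l where l: "l \<in> K" "\<forall>u\<in>V. l u = k (h u)"
    using mult[OF k(1) assms(1)] by blast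
  then have "y = l u"
    using k(2) assms(2) by simp
  then show "y \<in> (\<lambda>k. k u) ` K"
    using l(1) by blast
next
  fix y assume "y \<in> (\<lambda>k. k u) ` K"
  then obtain k where k: "k \<in> K" "y = k u"
    by blast
  obtain h' where h': "h' \<in> K" "\<forall>u\<in>V. h' (h u) = u \<and> h (h' u) = u"
    using inverse assms(1) by blast
  obtain l where l: "l \<in> K" "\<forall>u\<in>V. l u = k (h' u)"
    using mult k(1) h'(1) by blast
  have "y = l (h u)"
    using l(2) h'(2) k(2) assms maps by simp
  then show "y \<in> (\<lambda>k. k (h u)) ` K"
    using l(1) by blast
qed

definition max_norm :: "'a \<Rightarrow> real" where
  "max_norm u = Sup (norm ` (\<lambda>k. k u) ` K)"

definition min_norm :: "'a \<Rightarrow> real" where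
  "min_norm u = Inf (norm ` (\<lambda>k. k u) ` K)"

lemma max_norm_shift: "\<lbrakk>h \<in> K; u \<in> V\<rbrakk> \<Longrightarrow> max_norm (h u) = max_norm u"
  and min_norm_shift: "\<lbrakk>h \<in> K; u \<in> V\<rbrakk> \<Longrightarrow> min_norm (h u) = min_norm u"
  by (simp_all add: max_norm_def min_norm_def orbit_shift)

lemma compact_norms: "compact (norm ` (\<lambda>k. k u) ` K)"
  by (intro compact_continuous_image continuous_on_eval compact_K continuous_on_norm_id)

lemma id_on: "\<exists>k\<in>K. \<forall>u\<in>V. k u = u"
proof -
  obtain k where k: "k \<in> K" using nonempty by blast
  obtain h where h: "h \<in> K" "\<forall>u\<in>V. h (k u) = u"
    using inverse[OF k] by blast
  then show ?thesis
    using mult[OF h(1) k] by metis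
qed

lemma norm_le_max_norm: "u \<in> V \<Longrightarrow> norm u \<le> max_norm u"
  unfolding max_norm_def
  using id_on compact_norms[of u, THEN compact_imp_bounded, THEN bounded_imp_bdd_above]
  by (metis (no_types, lifting) cSup_upper image_eqI)

lemma min_norm_le_norm: "u \<in> V \<Longrightarrow> min_norm u \<le> norm u"
  unfolding min_norm_def
  using id_on compact_norms[of u, THEN compact_imp_bounded, THEN bounded_imp_bdd_below]
  by (metis (no_types, lifting) cInf_lower image_eqI)

lemma min_norm_nonneg: "min_norm u \<ge> 0"
  unfolding min_norm_def using nonempty by (intro cInf_greatest) auto

lemma min_norm_pos:
  assumes "u \<in> V" "u \<noteq> 0"
  shows "min_norm u > 0"
proof -
  have "min_norm u \<in> norm ` (\<lambda>k. k u) ` K"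
    unfolding min_norm_def
    using compact_norms[of u] nonempty
    by (intro closed_contains_Inf) (auto intro: compact_imp_closed compact_imp_bounded bounded_imp_bdd_below)
  then obtain k where k: "k \<in> K" "min_norm u = norm (k u)"
    by blast
  have "k u \<noteq> 0"
  proof
    assume "k u = 0"
    moreover obtain h where "h \<in> K" "h (k u) = u"
      using inverse[OF k(1)] assms(1) by blast
    moreover have "h 0 = 0" if "h \<in> K"
      using map_scale[OF that assms(1), of 0] by simp
    ultimately show False
      using assms(2) by simp
  qed
  then show ?thesis
    using k by simp
qed

text \<open>The upper bound makes this set compact, the lower bound keeps its elements positive definite. Both
are invariant under \<open>K\<close> since \<open>max_norm\<close> and \<open>min_norm\<close> are. Outside of \<open>V\<close> the forms are set to
zero, so that a form is determined by its values on \<open>V\<close>. Pairs are used as arguments, so that the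
topology is that of a single product.\<close>

definition forms :: "('a \<times> 'a \<Rightarrow> real) set" where
  "forms = {q. (\<forall>u v. u \<notin> V \<or> v \<notin> V \<longrightarrow> q (u, v) = 0) \<and>
     (\<forall>u. u \<in> V \<longrightarrow> (\<forall>v. v \<in> V \<longrightarrow> \<bar>q (u, v)\<bar> \<le> max_norm u * max_norm v)) \<and>
     (\<forall>u. u \<in> V \<longrightarrow> (\<forall>v. v \<in> V \<longrightarrow> q (u, v) = q (v, u))) \<and>
     (\<forall>u. u \<in> V \<longrightarrow> (\<forall>v. v \<in> V \<longrightarrow> (\<forall>w. w \<in> V \<longrightarrow> q (u + v, w) = q (u, w) + q (v, w)))) \<and>
     (\<forall>u. u \<in> V \<longrightarrow> (\<forall>v. v \<in> V \<longrightarrow> (\<forall>c. q (c *\<^sub>R u, v) = c * q (u, v)))) \<and>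
     (\<forall>u. u \<in> V \<longrightarrow> q (u, u) \<ge> (min_norm u)\<^sup>2)}"

lemma formsD:
  assumes "q \<in> forms"
  shows "u \<notin> V \<or> v \<notin> V \<Longrightarrow> q (u, v) = 0"
    and "\<lbrakk>u \<in> V; v \<in> V\<rbrakk> \<Longrightarrow> \<bar>q (u, v)\<bar> \<le> max_norm u * max_norm v"
    and "\<lbrakk>u \<in> V; v \<in> V\<rbrakk> \<Longrightarrow> q (u, v) = q (v, u)"
    and "\<lbrakk>u \<in> V; v \<in> V; w \<in> V\<rbrakk> \<Longrightarrow> q (u + v, w) = q (u, w) + q (v, w)"
    and "\<lbrakk>u \<in> V; v \<in> V\<rbrakk> \<Longrightarrow> q (c *\<^sub>R u, v) = c * q (u, v)"
    and "u \<in> V \<Longrightarrow> q (u, u) \<ge> (min_norm u)\<^sup>2"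
  using assms by (auto simp: forms_def)

lemma forms_inner_product:
  assumes "q \<in> forms"
  shows "inner_product_on V (\<lambda>u v. q (u, v))"
proof
  show "0 < q (u, u)" if "u \<in> V" "u \<noteq> 0" for u
    using formsD(6)[OF assms that(1)] min_norm_pos[OF that] by (smt (verit) zero_less_power)
qed (use formsD[OF assms] subspace_V in auto)

text \<open>By Tychonoff's theorem, a closed subset of a product of compact intervals.\<close>

lemma compact_forms: "compact forms"
proof -
  let ?box = "PiE UNIV (\<lambda>(u, v). if u \<in> V \<and> v \<in> V
    then cball 0 (max_norm u * max_norm v) else {0}) :: ('a \<times> 'a \<Rightarrow> real) set"
  have "compactin (product_topology (\<lambda>_. euclidean) UNIV) ?box"
    by (subst compactin_PiE) auto
  then have "compact ?box"
    by (simp add: euclidean_product_topology)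
  moreover have "closed forms"
    unfolding forms_def
    by (intro closed_Collect_conj closed_Collect_all closed_Collect_imp closed_Collect_eq
        closed_Collect_le open_Collect_const continuous_intros continuous_on_product_coordinates)
  moreover have "forms \<subseteq> ?box"
    using formsD(1,2) by (fastforce simp: PiE_iff)
  ultimately show ?thesis
    using compact_Int_closed[of ?box forms] by (simp add: Int_absorb1)
qed

lemma forms_shift:
  assumes "q \<in> forms" "h \<in> K"
  shows "(\<lambda>(u, v). if u \<in> V \<and> v \<in> V then q (h u, h v) else 0) \<in> forms"
proof -
  note q = formsD[OF assms(1)] and h = maps[OF assms(2)]
  have "\<bar>q (h u, h v)\<bar> \<le> max_norm u * max_norm v" if "u \<in> V" "v \<in> V" for u v
    using q(2)[of "h u" "h v"] h that by (simp add: max_norm_shift[OF assms(2)])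
  moreover have "q (h u, h u) \<ge> (min_norm u)\<^sup>2" if "u \<in> V" for u
    using q(6)[of "h u"] h that by (simp add: min_norm_shift[OF assms(2)])
  moreover have "q (h u, h v) = q (h v, h u)" if "u \<in> V" "v \<in> V" for u v
    using q(3) h that by blast
  ultimately show ?thesis
    unfolding forms_def
    using q(4,5) h map_add[OF assms(2)] map_scale[OF assms(2)]
      subspace_add[OF subspace_V] subspace_scale[OF subspace_V] by simp
qed

lemma forms_midpoint:
  assumes "q \<in> forms" "q' \<in> forms"
  shows "(\<lambda>x. (q x + q' x) / 2) \<in> forms"
proof -
  note q = formsD[OF assms(1)] and q' = formsD[OF assms(2)]
  have "\<bar>(q (u, v) + q' (u, v)) / 2\<bar> \<le> max_norm u * max_norm v" if "u \<in> V" "v \<in> V" for u v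
    using q(2)[OF that] q'(2)[OF that] by (auto simp: abs_le_iff field_simps)
  moreover have "(q (u, u) + q' (u, u)) / 2 \<ge> (min_norm u)\<^sup>2" if "u \<in> V" for u
    using q(6)[OF that] q'(6)[OF that] by (simp add: field_simps)
  ultimately show ?thesis
    unfolding forms_def using q(1,3-5) q'(1,3-5) by (auto simp: field_simps)
qed

lemma forms_nonempty: "(\<lambda>(u, v). if u \<in> V \<and> v \<in> V then u \<bullet> v else 0) \<in> forms"
proof -
  have "\<bar>u \<bullet> v\<bar> \<le> max_norm u * max_norm v" if "u \<in> V" "v \<in> V" for u v
  proof -
    have "\<bar>u \<bullet> v\<bar> \<le> norm u * norm v"
      by (rule Cauchy_Schwarz_ineq2)
    also have "\<dots> \<le> max_norm u * max_norm v"
      using norm_le_max_norm that by (intro mult_mono) (auto intro: order_trans[OF norm_ge_zero])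
    finally show ?thesis .
  qed
  moreover have "u \<bullet> u \<ge> (min_norm u)\<^sup>2" if "u \<in> V" for u
    using min_norm_le_norm[OF that] min_norm_nonneg[of u]
    unfolding power2_norm_eq_inner[symmetric] by (rule power_mono)
  ultimately show ?thesis
    unfolding forms_def using subspace_add[OF subspace_V] subspace_scale[OF subspace_V]
    by (auto simp: inner_add_left intro: inner_commute)
qed

text \<open>If \<open>q\<close> minimises \<open>F\<close> and \<open>q'\<close> is its translate by \<open>h\<close>, then \<open>q'\<close> minimises \<open>F\<close> too. At an
element \<open>k\<close> where the midpoint attains its maximum, the parallelogram law forces the difference of
\<open>q\<close> and \<open>q'\<close> to vanish after translation by \<open>k\<close>, hence to vanish.\<close>

lemma invariant_inner_product:
  obtains b where "inner_product_on V b"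
    "\<And>k u v. \<lbrakk>k \<in> K; u \<in> V; v \<in> V\<rbrakk> \<Longrightarrow> b (k u) (k v) = b u v"
proof -
  obtain S where "S \<subseteq> V" "independent S" "V \<subseteq> span S"
    using basis_exists by metis
  then have S: "finite S" "span S = V" "S \<subseteq> V"
    using subspace_V independent_imp_finite by (auto simp: span_minimal subset_antisym)
  \<comment> \<open>The squared Euclidean norm of the matrix of the form \<open>q\<close> translated by \<open>k\<close>.\<close>
  define N where "N k q = (\<Sum>s\<in>S. \<Sum>t\<in>S. (q (k s, k t))\<^sup>2)" for k :: "'a \<Rightarrow> 'a" and q :: "'a \<times> 'a \<Rightarrow> real"
  have N_nonneg: "N k q \<ge> 0" for k q
    by (simp add: N_def sum_nonneg)
  have N_max: "\<exists>k\<in>K. \<forall>l\<in>K. N l q \<le> N k q" if "q \<in> forms" for q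
  proof -
    interpret Q: inner_product_on V "\<lambda>u v. q (u, v)"
      by (rule forms_inner_product[OF that])
    have "continuous_on K (\<lambda>k. q (k s, k t))" if "s \<in> S" "t \<in> S" for s t
      by (rule Q.continuous_on_form) (use that S(3) maps continuous_on_eval in auto)
    then have "continuous_on K (\<lambda>k. N k q)"
      unfolding N_def by (intro continuous_on_sum continuous_on_power)
    then show ?thesis
      using continuous_attains_sup[OF compact_K nonempty] by blast
  qed
  define F where "F q = (SUP k\<in>K. N k q)" for q
  have F_max: "\<exists>k\<in>K. F q = N k q" if q: "q \<in> forms" for q
  proof -
    obtain k where k: "k \<in> K" "\<And>l. l \<in> K \<Longrightarrow> N l q \<le> N k q"
      using N_max[OF q] by blast
    then have "F q = N k q"
      unfolding F_def by (intro cSup_eq_maximum) auto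
    then show ?thesis
      using k by blast
  qed
  have F_ub: "N k q \<le> F q" if q: "q \<in> forms" and "k \<in> K" for k q
  proof -
    have "bdd_above ((\<lambda>k. N k q) ` K)"
      using N_max[OF q] by auto
    then show ?thesis
      unfolding F_def using that(2) by (rule cSUP_upper[rotated])
  qed
  define \<mu> where "\<mu> = (INF q\<in>forms. F q)"
  have F_nonneg: "F q \<ge> 0" if "q \<in> forms" for q
    using F_max[OF that] N_nonneg by metis
  then have \<mu>_le: "\<mu> \<le> F q" if "q \<in> forms" for q
    unfolding \<mu>_def using that by (intro cINF_lower) (auto intro!: bdd_belowI[of _ 0])
  define L where "L c = (\<Inter>k\<in>K. {q. N k q \<le> c})" for c
  \<comment> \<open>\<open>L c\<close> is a sublevel set of \<open>F\<close>. It is closed since \<open>F\<close> is a supremum of continuous functions,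
so compactness provides a form in all of the \<open>L c\<close> with \<open>c > \<mu>\<close>, which is a minimum.\<close>
  have "forms \<inter> (\<Inter>c\<in>{\<mu><..}. L c) \<noteq> {}"
  proof (rule compact_imp_fip_image[OF compact_forms])
    show "closed (L c)" for c
      unfolding L_def N_def
      by (intro closed_INT ballI closed_Collect_le continuous_on_sum continuous_on_power
          continuous_on_product_coordinates continuous_on_const)
  next
    fix I assume I: "finite I" "I \<subseteq> {\<mu><..}"
    show "forms \<inter> (\<Inter>c\<in>I. L c) \<noteq> {}"
    proof (cases "I = {}")
      case True
      then show ?thesis using forms_nonempty by auto
    next
      case False
      then have "\<mu> < Min I"
        using I by auto
      moreover have "forms \<noteq> {}"
        using forms_nonempty by blast
      ultimately obtain q where q: "q \<in> forms" "F q < Min I"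
        unfolding \<mu>_def using cINF_less_iff[OF _ bdd_belowI2[of forms 0 F]] F_nonneg by blast
      then have "q \<in> L c" if "c \<in> I" for c
        using F_ub[OF q(1)] Min_le[OF I(1) that] by (force simp: L_def)
      then show ?thesis
        using q(1) by blast
    qed
  qed
  then obtain q where "q \<in> forms \<inter> (\<Inter>c\<in>{\<mu><..}. L c)"
    by (elim exE[OF ex_in_conv[THEN iffD2]])
  then have q: "q \<in> forms" "\<And>c. c > \<mu> \<Longrightarrow> q \<in> L c"
    by simp_all
  have N_q: "N k q \<le> \<mu>" if "k \<in> K" for k
  proof (rule dense_ge)
    fix c assume "\<mu> < c"
    then have "q \<in> L c" by (rule q(2))
    then show "N k q \<le> c" using that by (simp add: L_def)
  qed
  have "q (h u, h v) = q (u, v)" if h: "h \<in> K" and uv: "u \<in> V" "v \<in> V" for h u v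
  proof -
    define q' where "q' = (\<lambda>(u, v). if u \<in> V \<and> v \<in> V then q (h u, h v) else 0)"
    have q': "q' \<in> forms"
      unfolding q'_def by (rule forms_shift[OF q(1) h])
    have N_q': "N k q' \<le> \<mu>" if k: "k \<in> K" for k
    proof -
      obtain l where l: "l \<in> K" "\<forall>u\<in>V. l u = h (k u)"
        using mult[OF h k] by blast
      have "N k q' = N l q"
        unfolding N_def using S(3) l(2) maps[OF k]
        by (intro sum.cong refl) (auto simp: q'_def subset_iff)
      then show ?thesis
        using N_q[OF l(1)] by simp
    qed
    let ?m = "\<lambda>x. (q x + q' x) / 2" and ?d = "\<lambda>x. q x - q' x"
    have m: "?m \<in> forms"
      by (rule forms_midpoint[OF q(1) q'])
    have parallelogram: "4 * N k ?m + N k ?d = 2 * N k q + 2 * N k q'" for k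
      unfolding N_def sum_distrib_left sum.distrib[symmetric]
      by (intro sum.cong refl) (simp add: power2_eq_square field_simps)
    obtain k where k: "k \<in> K" "F ?m = N k ?m"
      using F_max[OF m] by blast
    have "N k ?d \<le> 0"
      using parallelogram[of k] N_q[OF k(1)] N_q'[OF k(1)] \<mu>_le[OF m] k(2) by linarith
    then have "N k ?d = 0"
      using N_nonneg[of k ?d] by linarith
    then have d0: "?d (k s, k t) = 0" if "s \<in> S" "t \<in> S" for s t
      using that S(1) by (auto simp: N_def sum_nonneg_eq_0_iff sum_nonneg)
    interpret D: symmetric_bilinear_on V "\<lambda>u v. ?d (k u, k v)"
      by unfold_locales
        (use formsD(3-5)[OF q(1)] formsD(3-5)[OF q'] maps[OF k(1)] map_add[OF k(1)]
          map_scale[OF k(1)] subspace_V in \<open>auto simp: algebra_simps\<close>)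
    obtain k' where k': "k' \<in> K" "\<forall>u\<in>V. k (k' u) = u"
      using inverse[OF k(1)] by blast
    have "?d (k (k' u), k (k' v)) = 0"
      using D.zero_on_span[OF S(2) d0] maps[OF k'(1)] uv by blast
    then show ?thesis
      using k'(2) uv by (simp add: q'_def)
  qed
  then show thesis
    using that[OF forms_inner_product[OF q(1)]] by blast
qed

end

lemma compact_linear_group_Int:
  fixes \<gg> :: "'a::euclidean_space set"
  assumes "lie_algebra \<gg> br" "subspace \<kk>" "\<kk> \<subseteq> \<gg>" "compact (carrier (Int_group \<gg> br \<kk>))"
  shows "compact_linear_group \<gg> (carrier (Int_group \<gg> br \<kk>))"
proof
  note se = symmetric_exps[OF assms(1-3)]
  show "subspace \<gg>"
    by (rule lie_algebra.subspace[OF assms(1)])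
  show "carrier (Int_group \<gg> br \<kk>) \<noteq> {}"
    using Int_group_id by blast
  show "compact (carrier (Int_group \<gg> br \<kk>))"
    by fact
  fix k assume k: "k \<in> carrier (Int_group \<gg> br \<kk>)"
  note lin = Int_group_linear[OF assms(1-3) k]
  show "k u \<in> \<gg>" if "u \<in> \<gg>" for u
    using lin that by blast
  show "k (u + v) = k u + k v" if "u \<in> \<gg>" "v \<in> \<gg>" for u v
    using lin that by blast
  show "k (c *\<^sub>R u) = c *\<^sub>R k u" if "u \<in> \<gg>" for u c
    using lin that by blast
  show "\<exists>l\<in>carrier (Int_group \<gg> br \<kk>). \<forall>u\<in>\<gg>. l u = k (h u)"
    if "h \<in> carrier (Int_group \<gg> br \<kk>)" for h
    using Int_group_compose[OF se k that] by (intro bexI) (auto simp: compose_def)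
  show "\<exists>h\<in>carrier (Int_group \<gg> br \<kk>). \<forall>u\<in>\<gg>. h (k u) = u \<and> k (h u) = u"
    by (rule Int_group_inverse[OF se k])
qed

section \<open>Lie algebras and Cartan decompositions\<close>

lemma eq_neg_self_iff: "a = - a \<longleftrightarrow> a = 0" for a :: "'a::real_vector"
proof
  assume "a = - a"
  then have "a + a = 0"
    by (simp only: eq_neg_iff_add_eq_0)
  then have "2 *\<^sub>R a = 0"
    by (simp only: scaleR_2)
  then show "a = 0" by simp
qed simp

context lie_algebra
begin

lemma zero_in: "0 \<in> \<gg>"
  and add_in: "\<lbrakk>x \<in> \<gg>; y \<in> \<gg>\<rbrakk> \<Longrightarrow> x + y \<in> \<gg>"
  and diff_in: "\<lbrakk>x \<in> \<gg>; y \<in> \<gg>\<rbrakk> \<Longrightarrow> x - y \<in> \<gg>"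
  and scale_in: "x \<in> \<gg> \<Longrightarrow> c *\<^sub>R x \<in> \<gg>"
  and neg_in: "x \<in> \<gg> \<Longrightarrow> - x \<in> \<gg>"
  using subspace by (auto intro: subspace_0 subspace_add subspace_diff subspace_scale subspace_neg)

lemma br_minus_left: "\<lbrakk>x \<in> \<gg>; y \<in> \<gg>\<rbrakk> \<Longrightarrow> br (- x) y = - br x y"
  using br_scale_left[of x y "-1"] by simp

lemma br_minus_right: "\<lbrakk>x \<in> \<gg>; y \<in> \<gg>\<rbrakk> \<Longrightarrow> br x (- y) = - br x y"
  using br_scale_right[of x y "-1"] by simp

lemma br_diff_left: "\<lbrakk>x \<in> \<gg>; y \<in> \<gg>; z \<in> \<gg>\<rbrakk> \<Longrightarrow> br (x - y) z = br x z - br y z"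
  using br_add_left[of x "- y" z] br_minus_left[of y z] neg_in[of y] by simp

lemma br_zero_left: "x \<in> \<gg> \<Longrightarrow> br 0 x = 0"
  using br_scale_left[of x x 0] by simp

lemma br_zero_right: "x \<in> \<gg> \<Longrightarrow> br x 0 = 0"
  using br_scale_right[of x x 0] by simp

lemma br_commute:
  assumes "x \<in> \<gg>" "y \<in> \<gg>"
  shows "br x y = - br y x"
proof -
  have "br (x + y) (x + y) = br x x + br x y + (br y x + br y y)"
    using assms add_in by (simp add: br_add_left br_add_right)
  then have "br x y + br y x = 0"
    using assms br_self add_in by simp
  then show ?thesis
    by (simp add: eq_neg_iff_add_eq_0)
qed

text \<open>The Jacobi identity in the form \<open>ad [x,y] = [ad x, ad y]\<close>.\<close>

lemma jacobi_left:
  assumes "x \<in> \<gg>" "y \<in> \<gg>" "z \<in> \<gg>"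
  shows "br (br x y) z = br x (br y z) - br y (br x z)"
proof -
  have "br (br x y) z = - br z (br x y)" "br y (br z x) = - br y (br x z)"
    using assms br_commute[of "br x y" z] br_commute[of z x] by (simp_all add: br_closed br_minus_right)
  then show ?thesis
    using jacobi[OF assms] by (simp add: algebra_simps add_eq_0_iff)
qed

lemma abelian_ideal_trivial:
  assumes "semisimple \<gg> br" "lie_ideal I \<gg> br" and "\<And>x y. \<lbrakk>x \<in> I; y \<in> I\<rbrakk> \<Longrightarrow> br x y = 0"
  shows "I = {0}"
proof -
  have "span {br x y | x y. x \<in> I \<and> y \<in> I} \<subseteq> {0}"
    by (rule span_minimal) (use assms(3) in auto)
  then have "span {br x y | x y. x \<in> I \<and> y \<in> I} = {0}"
    by (auto simp: span_zero)
  then have "(derived_algebra br ^^ 1) I = {0}"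
    by (simp add: derived_algebra_def)
  then have "solvable_lie_algebra I br"
    unfolding solvable_lie_algebra_def by blast
  then show ?thesis
    using assms(1,2) by (simp add: semisimple_def)
qed

text \<open>The line spanned by a central element is an abelian ideal.\<close>

lemma center_trivial:
  assumes "semisimple \<gg> br" "x \<in> \<gg>" "\<And>u. u \<in> \<gg> \<Longrightarrow> br x u = 0"
  shows "x = 0"
proof -
  have ux: "br u x = 0" if "u \<in> \<gg>" for u
    using br_commute[OF that assms(2)] assms(3)[OF that] by simp
  have "br u y \<in> span {x}" if "u \<in> \<gg>" "y \<in> span {x}" for u y
    using ux[OF that(1)] that assms(2) span_zero by (auto simp: span_singleton br_scale_right)
  moreover have "span {x} \<subseteq> \<gg>"
    using assms(2) subspace by (simp add: span_minimal)
  ultimately have "lie_ideal (span {x}) \<gg> br"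
    by (simp add: lie_ideal_def)
  moreover have "br y z = 0" if "y \<in> span {x}" "z \<in> span {x}" for y z
    using that assms(2) br_self scale_in
    by (auto simp: span_singleton br_scale_left br_scale_right)
  ultimately have "span {x} = {0}"
    using abelian_ideal_trivial[OF assms(1)] by blast
  then show ?thesis
    using span_base[of x "{x}"] by simp
qed

end

context symmetric_lie_algebra
begin

abbreviation "\<kk> \<equiv> kpart \<gg> s"
abbreviation "\<pp> \<equiv> ppart \<gg> s"

lemma s_minus: "x \<in> \<gg> \<Longrightarrow> s (- x) = - s x"
  using s_scale[of x "-1"] by simp

lemma kI: "\<lbrakk>x \<in> \<gg>; s x = x\<rbrakk> \<Longrightarrow> x \<in> \<kk>" and pI: "\<lbrakk>x \<in> \<gg>; s x = - x\<rbrakk> \<Longrightarrow> x \<in> \<pp>"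
  and kD: "x \<in> \<kk> \<Longrightarrow> x \<in> \<gg>" and pD: "x \<in> \<pp> \<Longrightarrow> x \<in> \<gg>"
  and k_fix: "x \<in> \<kk> \<Longrightarrow> s x = x" and p_neg: "x \<in> \<pp> \<Longrightarrow> s x = - x"
  by (auto simp: kpart_def ppart_def)

lemma s_zero: "s 0 = 0"
  using s_scale[OF zero_in, of 0] by simp

lemma subspace_k: "subspace \<kk>"
  using add_in scale_in zero_in s_add s_scale s_zero by (auto simp: subspace_def kpart_def)

lemma subspace_p: "subspace \<pp>"
  using add_in scale_in zero_in s_add s_scale s_zero by (auto simp: subspace_def ppart_def)

lemma br_kp: "\<lbrakk>x \<in> \<kk>; y \<in> \<pp>\<rbrakk> \<Longrightarrow> br x y \<in> \<pp>"
  by (intro pI) (simp_all add: kD pD br_closed s_br k_fix p_neg br_minus_right)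

lemma br_pk: "\<lbrakk>x \<in> \<pp>; y \<in> \<kk>\<rbrakk> \<Longrightarrow> br x y \<in> \<pp>"
  by (intro pI) (simp_all add: kD pD br_closed s_br k_fix p_neg br_minus_left)

lemma br_pp: "\<lbrakk>x \<in> \<pp>; y \<in> \<pp>\<rbrakk> \<Longrightarrow> br x y \<in> \<kk>"
  by (intro kI) (simp_all add: pD br_closed s_br p_neg br_minus_right br_minus_left neg_in)

lemma Cartan_decomposition:
  assumes "x \<in> \<gg>"
  obtains y z where "y \<in> \<kk>" "z \<in> \<pp>" "x = y + z"
proof
  let ?y = "(1/2) *\<^sub>R (x + s x)" and ?z = "(1/2) *\<^sub>R (x - s x)"
  have sx: "s x \<in> \<gg>" "s (- s x) = - x"
    using assms s_closed s_involutive s_minus by simp_all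
  show "?y \<in> \<kk>"
    using assms sx(1) by (intro kI) (simp_all add: add_in scale_in s_scale s_add s_involutive add.commute)
  have "s (x - s x) = s x - x"
    using s_add[OF assms neg_in[OF sx(1)]] sx by simp
  then show "?z \<in> \<pp>"
    using assms sx(1) by (intro pI) (simp_all add: diff_in scale_in s_scale flip: scaleR_minus_right)
  show "x = ?y + ?z"
    by (simp add: scaleR_add_right[symmetric] flip: scaleR_2)
qed

end

lemma symmetric_lie_subalgebra_algebra:
  fixes \<gg> :: "'a::euclidean_space set"
  assumes "symmetric_lie_algebra \<gg> br s" "symmetric_lie_subalgebra \<hh> \<gg> br s"
  shows "symmetric_lie_algebra \<hh> br s"
proof -
  interpret symmetric_lie_algebra \<gg> br s by fact
  have h: "subspace \<hh>" "\<And>x. x \<in> \<hh> \<Longrightarrow> x \<in> \<gg>" "\<And>x y. \<lbrakk>x \<in> \<hh>; y \<in> \<hh>\<rbrakk> \<Longrightarrow> br x y \<in> \<hh>"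
    "\<And>x. x \<in> \<hh> \<Longrightarrow> s x \<in> \<hh>"
    using assms(2) by (auto simp: symmetric_lie_subalgebra_def)
  obtain S where "S \<subseteq> \<hh>" "independent S" "\<hh> \<subseteq> span S"
    using basis_exists by metis
  then have "finite S \<and> span S = \<hh>"
    using h(1) independent_imp_finite by (auto simp: span_minimal subset_antisym)
  then show ?thesis
    by unfold_locales (use h br_add_left br_add_right br_scale_left br_scale_right br_self jacobi
        s_add s_scale s_br s_involutive in auto)
qed

text \<open>Differentiate \<open>q (exp (t ad x) u) v = q u (exp (- t ad x) v)\<close> at \<open>t = 0\<close>. Moving one exponential to
the other side makes both sides linear functions of a single curve, which are represented by
ambient inner products.\<close>

lemma invariant_form_skew:
  fixes \<gg> :: "'a::euclidean_space set"
  assumes g: "lie_algebra \<gg> br" and k: "subspace \<kk>" "\<kk> \<subseteq> \<gg>" and "symmetric_bilinear_on \<gg> q"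
    and inv: "\<And>\<phi> u v. \<lbrakk>\<phi> \<in> carrier (Int_group \<gg> br \<kk>); u \<in> \<gg>; v \<in> \<gg>\<rbrakk> \<Longrightarrow> q (\<phi> u) (\<phi> v) = q u v"
    and x: "x \<in> \<kk>" and u: "u \<in> \<gg>" and v: "v \<in> \<gg>"
  shows "q (br x u) v = - q u (br x v)"
proof -
  interpret lie_algebra \<gg> br by fact
  interpret q: symmetric_bilinear_on \<gg> q by fact
  have xg: "x \<in> \<gg>" "- x \<in> \<gg>"
    using x k neg_in by auto
  obtain a where a: "\<And>w. w \<in> \<gg> \<Longrightarrow> q w v = w \<bullet> a"
    using q.ex_inner_representation[OF v] by blast
  obtain b where b: "\<And>w. w \<in> \<gg> \<Longrightarrow> q w u = w \<bullet> b"
    using q.ex_inner_representation[OF u] by blast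
  have move: "exp_ad \<gg> br (t *\<^sub>R x) u \<bullet> a = exp_ad \<gg> br (t *\<^sub>R (- x)) v \<bullet> b" for t
  proof -
    have tx: "t *\<^sub>R x \<in> \<gg>" "t *\<^sub>R (- x) \<in> \<gg>" "t *\<^sub>R (- x) \<in> \<kk>"
      using xg scale_in x k subspace_neg[OF k(1)] subspace_scale[OF k(1)] by auto
    have "q (exp_ad \<gg> br (t *\<^sub>R x) u) v =
        q (exp_ad \<gg> br (t *\<^sub>R (- x)) (exp_ad \<gg> br (t *\<^sub>R x) u)) (exp_ad \<gg> br (t *\<^sub>R (- x)) v)"
      using inv[OF Int_group_exp[OF tx(3)]] exp_ad_in[OF g tx(1) u] v by simp
    also have "\<dots> = q u (exp_ad \<gg> br (t *\<^sub>R (- x)) v)"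
      using exp_ad_minus[OF g tx(1) u] by simp
    also have "\<dots> = q (exp_ad \<gg> br (t *\<^sub>R (- x)) v) u"
      using q.sym u exp_ad_in[OF g tx(2) v] by blast
    finally show ?thesis
      using a b exp_ad_in[OF g tx(1) u] exp_ad_in[OF g tx(2) v] by simp
  qed
  have "((\<lambda>t. exp_ad \<gg> br (t *\<^sub>R x) u \<bullet> a) has_vector_derivative br x u \<bullet> a) (at 0)"
    using bounded_linear.has_vector_derivative[OF bounded_linear_inner_left
        exp_ad_has_vector_derivative[OF g xg(1) u]] .
  moreover have "((\<lambda>t. exp_ad \<gg> br (t *\<^sub>R (- x)) v \<bullet> b) has_vector_derivative br (- x) v \<bullet> b) (at 0)"
    using bounded_linear.has_vector_derivative[OF bounded_linear_inner_left
        exp_ad_has_vector_derivative[OF g xg(2) v]] .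
  ultimately have "br x u \<bullet> a = br (- x) v \<bullet> b"
    unfolding move by (rule vector_derivative_unique_at)
  then have "q (br x u) v = q (br (- x) v) u"
    using a b xg u v by (simp add: br_closed)
  then show ?thesis
    using xg u v by (simp add: br_minus_left q.minus_left br_closed q.sym)
qed

section \<open>The Killing form\<close>

text \<open>What remains of compactness for the algebraic part of the proof: an inner product for which
\<open>ad \<kk>\<close> is skew. The orthonormal basis \<open>E\<close> serves to write traces as \<open>\<Sum> q (f e) e\<close>.\<close>

locale symmetric_lie_algebra_with_inner_product =
  symmetric_lie_algebra \<gg> br s + inner_product_on \<gg> q
  for \<gg> :: "'a::euclidean_space set" and br s q +
  fixes E :: "'a set"
  assumes semisimple: "semisimple \<gg> br"
    and skew: "\<lbrakk>x \<in> kpart \<gg> s; u \<in> \<gg>; v \<in> \<gg>\<rbrakk> \<Longrightarrow> q (br x u) v = - q u (br x v)"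
    and finite_E: "finite E" and span_E: "span E = \<gg>"
    and orthonormal: "\<lbrakk>e \<in> E; e' \<in> E\<rbrakk> \<Longrightarrow> q e e' = (if e = e' then 1 else 0)"
begin

lemma E_in: "e \<in> E \<Longrightarrow> e \<in> \<gg>"
  using span_E span_base by blast

definition endo_on :: "('a \<Rightarrow> 'a) \<Rightarrow> bool" where
  "endo_on f \<longleftrightarrow> (\<forall>u\<in>\<gg>. f u \<in> \<gg> \<and> (\<forall>c. f (c *\<^sub>R u) = c *\<^sub>R f u) \<and> (\<forall>v\<in>\<gg>. f (u + v) = f u + f v))"

lemma endo_on_sum:
  assumes "endo_on f" "finite I" "\<And>i. i \<in> I \<Longrightarrow> u i \<in> \<gg>"
  shows "f (\<Sum>i\<in>I. c i *\<^sub>R u i) = (\<Sum>i\<in>I. c i *\<^sub>R f (u i))"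
  using assms(2,3)
proof (induction rule: finite_induct)
  case empty
  have "f (0 *\<^sub>R 0) = 0 *\<^sub>R f 0"
    using assms(1) zero_in unfolding endo_on_def by blast
  then show ?case by simp
next
  case (insert i I)
  have "(\<Sum>j\<in>I. c j *\<^sub>R u j) \<in> \<gg>"
    using insert by (intro subspace_sum subspace_scale subspace) auto
  then show ?case
    using insert assms(1) scale_in by (simp add: endo_on_def)
qed

lemma endo_on_ad: "x \<in> \<gg> \<Longrightarrow> endo_on (br x)"
  by (simp add: endo_on_def br_closed br_scale_right br_add_right)

lemma endo_on_compose: "\<lbrakk>endo_on f; endo_on h\<rbrakk> \<Longrightarrow> endo_on (\<lambda>u. f (h u))"
  by (simp add: endo_on_def)

definition trace_on :: "('a \<Rightarrow> 'a) \<Rightarrow> real" where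
  "trace_on f = (\<Sum>e\<in>E. q (f e) e)"

text \<open>Both sides are the double sum over \<open>e\<close> and \<open>e'\<close> of the products of matrix entries
\<open>q (h e) e' * q (f e') e\<close>.\<close>

lemma trace_on_commute:
  assumes "endo_on f" "endo_on h"
  shows "trace_on (\<lambda>u. f (h u)) = trace_on (\<lambda>u. h (f u))"
proof -
  have *: "q (f (h e)) e = (\<Sum>e'\<in>E. q (h e) e' * q (f e') e)"
    if "endo_on f" "endo_on h" "e \<in> E" for f h e
  proof -
    have he: "h e \<in> \<gg>" and fe: "\<And>e'. e' \<in> E \<Longrightarrow> f e' \<in> \<gg>"
      using that E_in by (auto simp: endo_on_def)
    have "q (f (h e)) e = q (f (\<Sum>e'\<in>E. q (h e) e' *\<^sub>R e')) e"
      using orthonormal_expansion[OF finite_E span_E orthonormal he] by simp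
    also have "\<dots> = q (\<Sum>e'\<in>E. q (h e) e' *\<^sub>R f e') e"
      using endo_on_sum[OF that(1) finite_E, of "\<lambda>e'. e'"] E_in by simp
    also have "\<dots> = (\<Sum>e'\<in>E. q (h e) e' * q (f e') e)"
      using fe that(3) E_in finite_E by (intro sum_left) auto
    finally show ?thesis .
  qed
  have "trace_on (\<lambda>u. f (h u)) = (\<Sum>e\<in>E. \<Sum>e'\<in>E. q (h e) e' * q (f e') e)"
    using *[OF assms] by (simp add: trace_on_def)
  also have "\<dots> = (\<Sum>e'\<in>E. \<Sum>e\<in>E. q (f e') e * q (h e) e')"
    by (subst sum.swap) (simp add: mult.commute)
  also have "\<dots> = trace_on (\<lambda>u. h (f u))"
    using *[OF assms(2,1)] by (simp add: trace_on_def)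
  finally show ?thesis .
qed

lemma trace_on_cong: "(\<And>u. u \<in> \<gg> \<Longrightarrow> f u = h u) \<Longrightarrow> trace_on f = trace_on h"
  using E_in by (simp add: trace_on_def)

lemma trace_on_diff:
  assumes "endo_on f" "endo_on h"
  shows "trace_on (\<lambda>u. f u - h u) = trace_on f - trace_on h"
proof -
  have "q (f e - h e) e = q (f e) e - q (h e) e" if "e \<in> E" for e
    using assms E_in[OF that] by (intro diff_left) (auto simp: endo_on_def)
  then show ?thesis
    by (simp add: trace_on_def sum_subtractf)
qed

text \<open>The Killing form.\<close>

definition B :: "'a \<Rightarrow> 'a \<Rightarrow> real" where
  "B x y = trace_on (\<lambda>u. br x (br y u))"

sublocale B: symmetric_bilinear_on \<gg> B
proof
  fix u v w assume "u \<in> \<gg>" "v \<in> \<gg>" "w \<in> \<gg>"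
  then have "q (br (u + v) (br w e)) e = q (br u (br w e)) e + q (br v (br w e)) e" if "e \<in> E" for e
    using E_in[OF that] by (simp add: br_add_left br_closed add_left)
  then show "B (u + v) w = B u w + B v w"
    by (simp add: B_def trace_on_def sum.distrib)
next
  fix u v and c :: real assume "u \<in> \<gg>" "v \<in> \<gg>"
  then have "q (br (c *\<^sub>R u) (br v e)) e = c * q (br u (br v e)) e" if "e \<in> E" for e
    using E_in[OF that] by (simp add: br_scale_left br_closed scale_left)
  then show "B (c *\<^sub>R u) v = c * B u v"
    by (simp add: B_def trace_on_def sum_distrib_left)
next
  fix u v assume "u \<in> \<gg>" "v \<in> \<gg>"
  then show "B u v = B v u"
    unfolding B_def by (intro trace_on_commute endo_on_ad)
qed (rule subspace)

lemma B_invariant: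
  assumes x: "x \<in> \<gg>" and y: "y \<in> \<gg>" and z: "z \<in> \<gg>"
  shows "B (br x y) z = B x (br y z)"
proof -
  note ad = endo_on_ad[OF x] endo_on_ad[OF y] endo_on_ad[OF z]
  have "B (br x y) z = trace_on (\<lambda>u. br x (br y (br z u)) - br y (br x (br z u)))"
    unfolding B_def using x y z by (intro trace_on_cong) (simp add: jacobi_left br_closed)
  also have "\<dots> = trace_on (\<lambda>u. br x (br y (br z u))) - trace_on (\<lambda>u. br y (br x (br z u)))"
    by (rule trace_on_diff[OF endo_on_compose[OF ad(1) endo_on_compose[OF ad(2,3)]]
        endo_on_compose[OF ad(2) endo_on_compose[OF ad(1,3)]]])
  also have "trace_on (\<lambda>u. br y (br x (br z u))) = trace_on (\<lambda>u. br x (br z (br y u)))"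
    by (rule trace_on_commute[OF ad(2) endo_on_compose[OF ad(1,3)]])
  also have "trace_on (\<lambda>u. br x (br y (br z u))) - \<dots> =
      trace_on (\<lambda>u. br x (br y (br z u)) - br x (br z (br y u)))"
    by (rule trace_on_diff[OF endo_on_compose[OF ad(1) endo_on_compose[OF ad(2,3)]]
        endo_on_compose[OF ad(1) endo_on_compose[OF ad(3,2)]], symmetric])
  also have "\<dots> = B x (br y z)"
  proof -
    have "br x (a - b) = br x a - br x b" if "a \<in> \<gg>" "b \<in> \<gg>" for a b
      using br_add_right[OF x that(1) neg_in[OF that(2)]] br_minus_right[OF x that(2)] by simp
    then show ?thesis
      unfolding B_def using x y z
      by (intro trace_on_cong) (simp add: jacobi_left br_closed)
  qed
  finally show ?thesis .
qed

lemma B_skew: "\<lbrakk>x \<in> \<gg>; y \<in> \<gg>; z \<in> \<gg>\<rbrakk> \<Longrightarrow> B (br x y) z = - B y (br x z)"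
  using B_invariant[of y x z] br_commute[of x y] by (simp add: B.minus_left br_closed)

text \<open>Skewness gives \<open>B x x = - \<Sum> q [x,e] [x,e]\<close>, which vanishes only if \<open>x\<close> is central.\<close>

lemma B_negative_definite:
  assumes "x \<in> \<kk>" "x \<noteq> 0"
  shows "B x x < 0"
proof -
  have x: "x \<in> \<gg>" by (rule kD[OF assms(1)])
  have B_eq: "B x x = - (\<Sum>e\<in>E. q (br x e) (br x e))"
    unfolding B_def trace_on_def sum_negf[symmetric]
    using skew[OF assms(1)] x E_in br_closed by (intro sum.cong) auto
  have "\<exists>e\<in>E. br x e \<noteq> 0"
  proof (rule ccontr)
    assume "\<not> ?thesis"
    then have "br x u = 0" if "u \<in> \<gg>" for u
      using endo_on_sum[OF endo_on_ad[OF x] finite_E, of "\<lambda>e. e" "q u"]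
        orthonormal_expansion[OF finite_E span_E orthonormal that] E_in by simp
    then show False
      using center_trivial[OF semisimple x] assms(2) by blast
  qed
  then obtain e where "e \<in> E" "br x e \<noteq> 0"
    by blast
  then have "(\<Sum>e\<in>E. q (br x e) (br x e)) > 0"
    using x E_in br_closed nonneg pos finite_E by (intro sum_pos2[of E e]) auto
  then show ?thesis
    using B_eq by simp
qed

lemma inner_product_on_k: "inner_product_on \<kk> (\<lambda>x y. - B x y)"
  by unfold_locales (auto simp: subspace_k kD B.add_left B.scale_left B_negative_definite intro: B.sym)

text \<open>Let \<open>N\<close> be the radical of \<open>B\<close> on \<open>\<pp>\<close>. It is \<open>\<kk>\<close>-invariant as \<open>B\<close> is. For \<open>x \<in> N\<close> and \<open>y \<in> \<pp>\<close>,
invariance yields \<open>B [y,x] [y,x] = - B x [y,[y,x]] = 0\<close> because \<open>[y,[y,x]] \<in> \<pp>\<close>, and \<open>[y,x] \<in> \<kk>\<close>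
must be zero. Hence \<open>N\<close> is an ideal, it is abelian, and semisimplicity applies.\<close>

lemma B_nondegenerate_p:
  assumes "x \<in> \<pp>" "\<And>y. y \<in> \<pp> \<Longrightarrow> B x y = 0"
  shows "x = 0"
proof -
  define N where "N = {x \<in> \<pp>. \<forall>y\<in>\<pp>. B x y = 0}"
  have N_p: "N \<subseteq> \<pp>" by (auto simp: N_def)
  have "subspace N"
    using subspace_p pD unfolding N_def subspace_def
    by (auto simp: B.add_left B.scale_left B.zero_left)
  have kN: "br y x \<in> N" if "y \<in> \<kk>" "x \<in> N" for x y
    using that br_kp pD kD unfolding N_def by (auto simp: B_skew)
  have pN: "br y x = 0" if y: "y \<in> \<pp>" and x: "x \<in> N" for x y
  proof (rule ccontr)
    assume neq: "br y x \<noteq> 0"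
    have k: "br y x \<in> \<kk>"
      using br_pp that N_p by blast
    have "B (br y x) (br y x) = - B x (br y (br y x))"
      using x y k N_p pD kD by (intro B_skew) auto
    also have "\<dots> = 0"
      using br_pk[OF y k] x by (simp add: N_def)
    finally show False
      using B_negative_definite[OF k neq] by simp
  qed
  have "lie_ideal N \<gg> br"
    unfolding lie_ideal_def
  proof (intro conjI ballI \<open>subspace N\<close>)
    show "N \<subseteq> \<gg>" using N_p pD by blast
    fix z x assume "z \<in> \<gg>" "x \<in> N"
    obtain z1 z2 where z: "z1 \<in> \<kk>" "z2 \<in> \<pp>" "z = z1 + z2"
      using Cartan_decomposition[OF \<open>z \<in> \<gg>\<close>] by blast
    then have "br z x = br z1 x"
      using pN[OF z(2) \<open>x \<in> N\<close>] \<open>x \<in> N\<close> N_p pD kD by (auto simp: br_add_left)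
    then show "br z x \<in> N"
      using kN[OF z(1) \<open>x \<in> N\<close>] by simp
  qed
  then have "N = {0}"
    using abelian_ideal_trivial[OF semisimple] pN N_p by blast
  then show ?thesis
    using assms by (auto simp: N_def)
qed

end

lemma ex_invariant_inner_product:
  fixes \<gg> :: "'a::euclidean_space set"
  assumes "symmetric_lie_algebra \<gg> br s" "semisimple \<gg> br" "orthogonal_symmetric \<gg> br s"
  obtains q E where "symmetric_lie_algebra_with_inner_product \<gg> br s q E"
proof -
  interpret symmetric_lie_algebra \<gg> br s by fact
  have g: "lie_algebra \<gg> br" by unfold_locales
  have k: "subspace \<kk>" "\<kk> \<subseteq> \<gg>"
    using subspace_k kD by auto
  interpret K: compact_linear_group \<gg> "carrier (Int_group \<gg> br \<kk>)"
    using assms(3) by (intro compact_linear_group_Int g k) (simp add: orthogonal_symmetric_def)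
  obtain q where q: "inner_product_on \<gg> q"
    "\<And>\<phi> u v. \<lbrakk>\<phi> \<in> carrier (Int_group \<gg> br \<kk>); u \<in> \<gg>; v \<in> \<gg>\<rbrakk> \<Longrightarrow> q (\<phi> u) (\<phi> v) = q u v"
    using K.invariant_inner_product by blast
  interpret q: inner_product_on \<gg> q by fact
  obtain E where E: "finite E" "span E = \<gg>"
    "\<And>e e'. \<lbrakk>e \<in> E; e' \<in> E\<rbrakk> \<Longrightarrow> q e e' = (if e = e' then 1 else 0)"
    using q.ex_orthonormal_basis[OF subspace] by blast
  have "symmetric_lie_algebra_with_inner_product \<gg> br s q E"
    by unfold_locales
      (use assms(2) E invariant_form_skew[OF g k q.symmetric_bilinear_on_axioms q(2)] in auto)
  then show thesis
    by (rule that)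
qed

section \<open>Decomposition of the \<open>-1\<close> eigenspace\<close>

context symmetric_lie_algebra_with_inner_product
begin

text \<open>Invariance turns \<open>B [u,w] [u,w]\<close> into \<open>B u [w,[u,w]]\<close>, which is of the form in the third premise
up to sign, and \<open>B\<close> is definite on \<open>\<kk>\<close>.\<close>

lemma orthogonal_commute:
  assumes "u \<in> \<pp>" "w \<in> \<pp>" "\<And>y. y \<in> \<kk> \<Longrightarrow> B u (br y w) = 0"
  shows "br u w = 0"
proof (rule ccontr)
  assume neq: "br u w \<noteq> 0"
  have k: "br u w \<in> \<kk>"
    using assms br_pp by blast
  have "B (br u w) (br u w) = B u (br w (br u w))"
    using assms k pD kD by (intro B_invariant) auto
  also have "br w (br u w) = - br (br u w) w"
    using assms k pD kD by (intro br_commute) auto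
  also have "B u \<dots> = 0"
    using assms k pD kD br_kp by (simp add: B.minus_right)
  finally show False
    using B_negative_definite[OF k neq] by simp
qed

definition k_invariant :: "'a set \<Rightarrow> bool" where
  "k_invariant W \<longleftrightarrow> subspace W \<and> W \<subseteq> \<pp> \<and> (\<forall>x\<in>\<kk>. \<forall>w\<in>W. br x w \<in> W)"

definition k_irreducible :: "'a set \<Rightarrow> bool" where
  "k_irreducible V \<longleftrightarrow> k_invariant V \<and> V \<noteq> {0} \<and>
     (\<forall>U. k_invariant U \<and> U \<subseteq> V \<longrightarrow> U = {0} \<or> U = V)"

text \<open>Take a nonzero invariant subspace of least dimension.\<close>

lemma ex_k_irreducible:
  assumes "k_invariant W" "W \<noteq> {0}"
  obtains V where "V \<subseteq> W" "k_irreducible V"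
proof -
  define P where "P V \<longleftrightarrow> k_invariant V \<and> V \<noteq> {0} \<and> V \<subseteq> W" for V
  have "P W" using assms by (simp add: P_def)
  then obtain V where V: "P V" "\<And>U. P U \<Longrightarrow> dim V \<le> dim U"
    using ex_has_least_nat[of P W dim] by blast
  have "U = V" if "k_invariant U" "U \<subseteq> V" "U \<noteq> {0}" for U
  proof (rule subspace_dim_equal)
    have "P U"
      using that V(1) by (auto simp: P_def)
    then show "dim V \<le> dim U"
      by (rule V(2))
  qed (use that V(1) in \<open>auto simp: P_def k_invariant_def\<close>)
  then show thesis
    using that[of V] V(1) by (auto simp: P_def k_irreducible_def)
qed

text \<open>The eigenspace of \<open>B\<close> with respect to \<open>q\<close> for the largest eigenvalue, that is, for the maximum
\<open>\<beta>\<close> of the Rayleigh quotient: \<open>\<beta> q - B\<close> is positive semidefinite, so a maximum point lies in its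
radical. The eigenspace is invariant since \<open>ad \<kk>\<close> is skew for both forms.\<close>

lemma ex_B_eigenspace:
  assumes W: "k_invariant W" "W \<noteq> {0}"
  obtains U \<beta> where "U \<subseteq> W" "k_invariant U" "U \<noteq> {0}"
    "\<And>u w. \<lbrakk>u \<in> U; w \<in> W\<rbrakk> \<Longrightarrow> B u w = \<beta> * q u w"
proof -
  have subW: "subspace W" and Wg: "\<And>w. w \<in> W \<Longrightarrow> w \<in> \<gg>" and Wp: "W \<subseteq> \<pp>"
    and W_inv: "\<And>x w. \<lbrakk>x \<in> \<kk>; w \<in> W\<rbrakk> \<Longrightarrow> br x w \<in> W"
    using W(1) pD by (auto simp: k_invariant_def)
  define S where "S = sphere 0 1 \<inter> W"
  obtain w0 where "w0 \<in> W" "w0 \<noteq> 0"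
    using W(2) subspace_0[OF subW] by blast
  then have "w0 /\<^sub>R norm w0 \<in> S"
    using subspace_scale[OF subW] by (auto simp: S_def)
  then have "S \<noteq> {}" by blast
  have "compact S"
    unfolding S_def by (intro compact_Int_closed closed_subspace subW) auto
  have S: "u \<in> \<gg>" "u \<noteq> 0" if "u \<in> S" for u
    using that Wg by (auto simp: S_def)
  have "continuous_on S (\<lambda>u. B u u / q u u)"
    using S pos by (intro continuous_on_divide continuous_on_form B.continuous_on_form
        continuous_on_id) force+
  then obtain u0 where u0: "u0 \<in> S" "\<And>u. u \<in> S \<Longrightarrow> B u u / q u u \<le> B u0 u0 / q u0 u0"
    using continuous_attains_sup[OF \<open>compact S\<close> \<open>S \<noteq> {}\<close>] by blast
  define \<beta> where "\<beta> = B u0 u0 / q u0 u0"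
  interpret P: symmetric_bilinear_on W "\<lambda>u v. \<beta> * q u v - B u v"
    by unfold_locales (use subW Wg sym B.sym in
        \<open>auto simp: add_left scale_left B.add_left B.scale_left algebra_simps\<close>)
  have P_S: "\<beta> * q u u - B u u \<ge> 0" if "u \<in> S" for u
    using u0(2)[OF that] pos[OF S[OF that]] by (simp add: \<beta>_def[symmetric] field_simps)
  have psd: "\<beta> * q w w - B w w \<ge> 0" if "w \<in> W" for w
  proof (cases "w = 0")
    case True
    then show ?thesis using P.zero_left[OF that] by simp
  next
    case False
    let ?u = "w /\<^sub>R norm w"
    have u: "?u \<in> S"
      using False that subspace_scale[OF subW] by (auto simp: S_def)
    then have uW: "?u \<in> W" by (simp add: S_def)
    have "w = norm w *\<^sub>R ?u"
      using False by simp
    then have "\<beta> * q w w - B w w = norm w * (norm w * (\<beta> * q ?u ?u - B ?u ?u))"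
      using P.scale_left[of ?u w "norm w"] P.scale_right[of ?u ?u "norm w"] uW that by metis
    then show ?thesis
      using P_S[OF u] by simp
  qed
  define U where "U = {u \<in> W. \<forall>w\<in>W. B u w = \<beta> * q u w}"
  have u0W: "u0 \<in> W" "u0 \<noteq> 0"
    using u0(1) S(2) by (auto simp: S_def)
  have "\<beta> * q u0 u0 - B u0 u0 = 0"
    using pos[OF S[OF u0(1)]] by (simp add: \<beta>_def)
  then have "u0 \<in> U"
    using P.psd_isotropic_radical[OF psd u0W(1)] u0W(1) by (auto simp: U_def)
  have "subspace U"
    using subW Wg unfolding U_def subspace_def
    by (auto simp: add_left scale_left zero_left B.add_left B.scale_left B.zero_left algebra_simps)
  moreover have "br x u \<in> U" if x: "x \<in> \<kk>" and u: "u \<in> U" for x u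
  proof -
    have "B (br x u) w = \<beta> * q (br x u) w" if w: "w \<in> W" for w
    proof -
      have "B (br x u) w = - B u (br x w)"
        using x u w kD Wg by (intro B_skew) (auto simp: U_def)
      also have "\<dots> = - (\<beta> * q u (br x w))"
        using u W_inv[OF x w] by (simp add: U_def)
      also have "\<dots> = \<beta> * q (br x u) w"
        using skew[OF x] u w Wg by (simp add: U_def)
      finally show ?thesis .
    qed
    then show ?thesis
      using W_inv[OF x] u by (simp add: U_def)
  qed
  ultimately have "k_invariant U"
    using Wp by (auto simp: k_invariant_def U_def)
  moreover have "U \<noteq> {0}"
    using \<open>u0 \<in> U\<close> u0W(2) by blast
  ultimately show thesis
    by (intro that[of U \<beta>]) (simp_all add: U_def)
qed

text \<open>Choosing each summand inside an eigenspace of \<open>B\<close> makes its \<open>q\<close>-orthogonal complement in \<open>W\<close>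
also \<open>B\<close>-orthogonal to it. Orthogonality for \<open>q\<close> makes the sum direct, orthogonality for \<open>B\<close> makes
the summands commute.\<close>

lemma k_irreducible_decomposition:
  assumes "k_invariant W"
  shows "\<exists>(n::nat) V. (\<forall>i<n. k_irreducible (V i) \<and> V i \<subseteq> W) \<and>
    (\<forall>i<n. \<forall>j<n. i \<noteq> j \<longrightarrow> (\<forall>u\<in>V i. \<forall>v\<in>V j. q u v = 0 \<and> B u v = 0)) \<and>
    (\<forall>w\<in>W. \<exists>v. (\<forall>i<n. v i \<in> V i) \<and> w = (\<Sum>i<n. v i))"
  using assms
proof (induction "dim W" arbitrary: W rule: less_induct)
  case less
  show ?case
  proof (cases "W = {0}")
    case True
    then show ?thesis by (intro exI[of _ "0::nat"]) simp
  next
    case False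
    have subW: "subspace W" and Wg: "\<And>w. w \<in> W \<Longrightarrow> w \<in> \<gg>" and Wp: "W \<subseteq> \<pp>"
      and W_inv: "\<And>x w. \<lbrakk>x \<in> \<kk>; w \<in> W\<rbrakk> \<Longrightarrow> br x w \<in> W"
      using less.prems pD by (auto simp: k_invariant_def)
    obtain U \<beta> where U: "U \<subseteq> W" "k_invariant U" "U \<noteq> {0}"
      "\<And>u w. \<lbrakk>u \<in> U; w \<in> W\<rbrakk> \<Longrightarrow> B u w = \<beta> * q u w"
      using ex_B_eigenspace[OF less.prems False] by blast
    obtain X where X: "X \<subseteq> U" "k_irreducible X"
      using ex_k_irreducible[OF U(2,3)] by blast
    then have XW: "X \<subseteq> W" and subX: "subspace X" and X_inv: "\<And>x v. \<lbrakk>x \<in> \<kk>; v \<in> X\<rbrakk> \<Longrightarrow> br x v \<in> X"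
      using U(1) by (auto simp: k_irreducible_def k_invariant_def)
    define W' where "W' = {w \<in> W. \<forall>v\<in>X. q w v = 0}"
    have W'_B: "B w v = 0" if "w \<in> W'" "v \<in> X" for w v
    proof -
      have wv: "w \<in> W" "v \<in> U" "w \<in> \<gg>" "v \<in> \<gg>" "q w v = 0"
        using that X(1) XW Wg by (auto simp: W'_def)
      then show ?thesis
        using U(4)[OF wv(2,1)] by (simp add: sym[of v w] B.sym[of v w])
    qed
    have "subspace W'"
      using subW Wg XW unfolding W'_def subspace_def
      by (auto simp: add_left scale_left zero_left subset_iff)
    moreover have "br x w \<in> W'" if x: "x \<in> \<kk>" and w: "w \<in> W'" for x w
      using W_inv[OF x] X_inv[OF x] w XW Wg skew[OF x] by (auto simp: W'_def subset_iff)
    ultimately have W': "k_invariant W'"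
      using Wp by (auto simp: k_invariant_def W'_def)
    have "W' \<subset> W"
    proof -
      obtain v where "v \<in> X" "v \<noteq> 0"
        using X(2) subspace_0[OF subX] by (auto simp: k_irreducible_def)
      then have "v \<in> W" "v \<notin> W'"
        using XW Wg pos[of v] by (force simp: W'_def)+
      then show ?thesis by (auto simp: W'_def)
    qed
    then have "dim W' < dim W"
      using W' subW by (intro dim_psubset) (simp add: k_invariant_def span_eq_iff[THEN iffD2])
    from less.hyps[OF this W'] obtain n :: nat and V where V: "\<forall>i<n. k_irreducible (V i) \<and> V i \<subseteq> W'"
      "\<forall>i<n. \<forall>j<n. i \<noteq> j \<longrightarrow> (\<forall>u\<in>V i. \<forall>v\<in>V j. q u v = 0 \<and> B u v = 0)"
      "\<forall>w\<in>W'. \<exists>v. (\<forall>i<n. v i \<in> V i) \<and> w = (\<Sum>i<n. v i)"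
      by (elim exE conjE) (rule that)
    have VX: "q u v = 0 \<and> B u v = 0" "q v u = 0 \<and> B v u = 0" if "i < n" "u \<in> V i" "v \<in> X" for i u v
    proof -
      have "u \<in> W'" using V(1) that by blast
      then show "q u v = 0 \<and> B u v = 0"
        using that W'_B by (auto simp: W'_def)
      then show "q v u = 0 \<and> B v u = 0"
        using sym[of v u] B.sym[of v u] \<open>u \<in> W'\<close> that XW Wg by (auto simp: W'_def)
    qed
    let ?V = "V(n := X)"
    have "\<exists>v. (\<forall>i<Suc n. v i \<in> ?V i) \<and> w = (\<Sum>i<Suc n. v i)" if w: "w \<in> W" for w
    proof -
      obtain x where x: "x \<in> X" "\<And>v. v \<in> X \<Longrightarrow> q (w - x) v = 0"
        using orthogonal_projection[OF subX _ Wg[OF w]] XW Wg by blast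
      then have "w - x \<in> W'"
        using w XW subspace_diff[OF subW] by (auto simp: W'_def)
      then obtain v where v: "\<forall>i<n. v i \<in> V i" "w - x = (\<Sum>i<n. v i)"
        using V(3) by blast
      then show ?thesis
        using x(1) by (intro exI[of _ "v(n := x)"]) (auto simp: less_Suc_eq algebra_simps)
    qed
    moreover have "k_irreducible (?V i) \<and> ?V i \<subseteq> W" if "i < Suc n" for i
      using V(1) X(2) XW that by (auto simp: less_Suc_eq W'_def)
    moreover have "q u v = 0 \<and> B u v = 0"
      if "i < Suc n" "j < Suc n" "i \<noteq> j" "u \<in> ?V i" "v \<in> ?V j" for i j u v
      using that V(2) VX by (auto simp: less_Suc_eq split: if_splits)
    ultimately show ?thesis
      by (intro exI[of _ "Suc n"] exI[of _ ?V]) blast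
  qed
qed

end

section \<open>The ideal generated by a summand\<close>

context symmetric_lie_algebra_with_inner_product
begin

text \<open>All that the study of one summand \<open>V\<close> uses about the decomposition: \<open>\<pp>\<close> is the sum of \<open>V\<close> and
vectors that are \<open>B\<close>-orthogonal to \<open>V\<close>.\<close>

definition B_split :: "'a set \<Rightarrow> bool" where
  "B_split V \<longleftrightarrow> k_invariant V \<and> (\<forall>w\<in>\<pp>. \<exists>v\<in>V. \<forall>u\<in>V. B (w - v) u = 0)"

definition k_of :: "'a set \<Rightarrow> 'a set" where
  "k_of V = span {br u v | u v. u \<in> V \<and> v \<in> V}"

definition ideal_of :: "'a set \<Rightarrow> 'a set" where
  "ideal_of V = {y + v | y v. y \<in> k_of V \<and> v \<in> V}"

context
  fixes V :: "'a set"
  assumes split: "B_split V"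
begin

lemma V_subspace: "subspace V" and V_p: "v \<in> V \<Longrightarrow> v \<in> \<pp>" and V_in: "v \<in> V \<Longrightarrow> v \<in> \<gg>"
  and k_V: "\<lbrakk>y \<in> \<kk>; v \<in> V\<rbrakk> \<Longrightarrow> br y v \<in> V"
  using split pD by (auto simp: B_split_def k_invariant_def)

lemma k_of_k: "k_of V \<subseteq> \<kk>"
  unfolding k_of_def by (intro span_minimal subspace_k) (auto intro!: br_pp V_p)

lemma k_of_in: "y \<in> k_of V \<Longrightarrow> y \<in> \<gg>"
  using k_of_k kD by blast

lemma k_of_induct [consumes 1, case_names zero step]:
  assumes "y \<in> k_of V" and "P 0"
    and "\<And>c u v y. \<lbrakk>u \<in> V; v \<in> V; y \<in> k_of V; P y\<rbrakk> \<Longrightarrow> P (c *\<^sub>R br u v + y)"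
  shows "P y"
proof -
  have "y \<in> k_of V \<and> P y"
    using assms(1) unfolding k_of_def
  proof (induction rule: span_induct_alt)
    case base
    then show ?case using assms(2) by (simp add: span_zero)
  next
    case (step c x y)
    then obtain u v where "x = br u v" "u \<in> V" "v \<in> V" by blast
    with step show ?case
      using assms(3)[of u v y c] by (auto simp: k_of_def intro!: span_add span_scale intro: span_base)
  qed
  then show ?thesis ..
qed

lemma subspace_ideal_of: "subspace (ideal_of V)"
  unfolding ideal_of_def k_of_def by (intro subspace_sums subspace_span V_subspace)

lemma ideal_of_in: "x \<in> ideal_of V \<Longrightarrow> x \<in> \<gg>"
  using k_of_in V_in add_in by (auto simp: ideal_of_def)

lemma k_of_subset: "y \<in> k_of V \<Longrightarrow> y \<in> ideal_of V"
  using subspace_0[OF V_subspace] unfolding ideal_of_def by force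

lemma V_subset: "v \<in> V \<Longrightarrow> v \<in> ideal_of V"
  using span_zero unfolding ideal_of_def k_of_def by force

lemma br_V: "\<lbrakk>u \<in> V; v \<in> V\<rbrakk> \<Longrightarrow> br u v \<in> k_of V"
  unfolding k_of_def by (intro span_base) blast

text \<open>By the Jacobi identity, \<open>ad y\<close> is a derivation, and \<open>V\<close> is invariant under it.\<close>

lemma br_k_of:
  assumes y: "y \<in> \<kk>" and z: "z \<in> k_of V"
  shows "br y z \<in> k_of V"
  using z
proof (induction rule: k_of_induct)
  case zero
  then show ?case
    using br_zero_right[OF kD[OF y]] by (simp add: k_of_def span_zero)
next
  case (step c u v z)
  have "br y (br u v) = br (br y u) v + br u (br y v)"
    using jacobi_left[of y u v] y step V_in kD by simp
  moreover have "\<dots> \<in> k_of V"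
    using br_V[OF k_V[OF y step(1)] step(2)] br_V[OF step(1) k_V[OF y step(2)]]
    unfolding k_of_def by (rule span_add)
  ultimately have "c *\<^sub>R br y (br u v) + br y z \<in> k_of V"
    using step unfolding k_of_def by (auto intro!: span_add span_scale)
  moreover have "br y (c *\<^sub>R br u v + z) = c *\<^sub>R br y (br u v) + br y z"
    using y step k_of_in kD V_in by (simp add: br_add_right br_scale_right br_closed scale_in)
  ultimately show ?case by simp
qed

lemma symmetric_lie_subalgebra_ideal_of: "symmetric_lie_subalgebra (ideal_of V) \<gg> br s"
  unfolding symmetric_lie_subalgebra_def
proof (intro conjI ballI subspace_ideal_of)
  show "ideal_of V \<subseteq> \<gg>"
    using ideal_of_in by blast
next
  fix x y assume "x \<in> ideal_of V" "y \<in> ideal_of V"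
  then obtain a u b v where x: "x = a + u" "a \<in> k_of V" "u \<in> V" and y: "y = b + v" "b \<in> k_of V" "v \<in> V"
    by (auto simp: ideal_of_def)
  have ab: "a \<in> \<kk>" "b \<in> \<kk>"
    using x y k_of_k by auto
  have "br x y = (br a b + br u v) + (br a v + br u b)"
    using x y k_of_in V_in by (simp add: br_add_left br_add_right add_in)
  moreover have "br a b + br u v \<in> k_of V"
    using br_k_of[OF ab(1) y(2)] br_V[OF x(3) y(3)] unfolding k_of_def by (rule span_add)
  moreover have "br u b = - br b u"
    using br_commute x y V_in k_of_in by blast
  then have "br a v + br u b \<in> V"
    using k_V[OF ab(1) y(3)] k_V[OF ab(2) x(3)] subspace_diff[OF V_subspace] by simp
  ultimately show "br x y \<in> ideal_of V"
    unfolding ideal_of_def by blast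
next
  fix x assume "x \<in> ideal_of V"
  then obtain a u where x: "x = a + u" "a \<in> k_of V" "u \<in> V"
    by (auto simp: ideal_of_def)
  then have "s x = a + - u"
    using k_of_k V_p by (simp add: s_add k_fix p_neg k_of_in V_in subset_iff)
  then show "s x \<in> ideal_of V"
    using x subspace_neg[OF V_subspace] unfolding ideal_of_def by blast
qed

lemma symmetric_lie_algebra_ideal_of: "symmetric_lie_algebra (ideal_of V) br s"
  using symmetric_lie_subalgebra_algebra[OF symmetric_lie_algebra_axioms
      symmetric_lie_subalgebra_ideal_of] .

lemma kpart_ideal_of: "kpart (ideal_of V) s = k_of V"
  and ppart_ideal_of: "ppart (ideal_of V) s = V"
proof -
  have s: "s (a + u) = a - u" "a \<in> \<gg>" "u \<in> \<gg>" if "a \<in> k_of V" "u \<in> V" for a u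
    using that k_of_k V_p by (auto simp: s_add k_fix p_neg k_of_in V_in)
  have "x \<in> k_of V" if "x \<in> kpart (ideal_of V) s" for x
  proof -
    from that obtain a u where x: "x = a + u" "a \<in> k_of V" "u \<in> V" "s x = x"
      by (auto simp: ideal_of_def kpart_def)
    then have "a + - u = a + u"
      using s[OF x(2,3)] by simp
    then have "u = 0"
      using eq_neg_self_iff[of u] by (metis add_left_imp_eq)
    then show ?thesis using x by simp
  qed
  moreover have "y \<in> kpart (ideal_of V) s" if "y \<in> k_of V" for y
    using k_of_subset[OF that] k_fix k_of_k that by (auto simp: kpart_def)
  ultimately show "kpart (ideal_of V) s = k_of V"
    by blast
  have "x \<in> V" if "x \<in> ppart (ideal_of V) s" for x
  proof -
    from that obtain a u where x: "x = a + u" "a \<in> k_of V" "u \<in> V" "s x = - x"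
      by (auto simp: ideal_of_def ppart_def)
    then have "a - u = - a - u"
      using s[OF x(2,3)] by simp
    then have "a = 0"
      using eq_neg_self_iff[of a] by simp
    then show ?thesis using x by simp
  qed
  moreover have "v \<in> ppart (ideal_of V) s" if "v \<in> V" for v
    using V_subset[OF that] p_neg[OF V_p[OF that]] by (simp add: ppart_def)
  ultimately show "ppart (ideal_of V) s = V"
    by blast
qed

lemma centralizes_ideal_of:
  assumes z: "z \<in> \<gg>" and zV: "\<And>u. u \<in> V \<Longrightarrow> br z u = 0" and x: "x \<in> ideal_of V"
  shows "br z x = 0"
proof -
  have "br z y = 0" if "y \<in> k_of V" for y
    using that
  proof (induction rule: k_of_induct)
    case zero
    then show ?case by (rule br_zero_right[OF z])
  next
    case (step c u v y)
    have "br z (br u v) = br (br z u) v + br u (br z v)"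
      using jacobi_left[of z u v] z step V_in by simp
    also have "\<dots> = 0"
      using zV step V_in by (simp add: br_zero_left br_zero_right)
    finally show ?case
      using z step k_of_in V_in by (simp add: br_add_right br_scale_right br_closed scale_in)
  qed
  moreover obtain y v where "x = y + v" "y \<in> k_of V" "v \<in> V"
    using x by (auto simp: ideal_of_def)
  ultimately show ?thesis
    using z zV k_of_in V_in by (simp add: br_add_right)
qed

text \<open>\<open>B v w\<close> depends only on the component of \<open>w\<close> in \<open>V\<close>.\<close>

lemma B_nondegenerate_V:
  assumes v: "v \<in> V" and "\<And>u. u \<in> V \<Longrightarrow> B v u = 0"
  shows "v = 0"
proof (rule B_nondegenerate_p)
  show "v \<in> \<pp>" by (rule V_p[OF v])
  fix w assume w: "w \<in> \<pp>"
  then obtain u where u: "u \<in> V" "\<forall>v\<in>V. B (w - u) v = 0"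
    using split by (auto simp: B_split_def)
  have wu: "w \<in> \<gg>" "u \<in> \<gg>" "w - u \<in> \<gg>" "v \<in> \<gg>"
    using w u v pD V_in diff_in by auto
  have "B v w = B (w - u) v + B v u"
    using wu B.diff_left[of w u v] B.sym[of w v] B.sym[of u v] by simp
  then show "B v w = 0"
    using u v assms(2) by simp
qed

text \<open>The element \<open>y\<close> is the orthogonal projection of \<open>x\<close> to \<open>[V,V]\<close> for the inner product \<open>- B\<close> on
\<open>\<kk>\<close>. The remainder \<open>z\<close> satisfies \<open>B [z,u] v = B z [u,v] = 0\<close> for \<open>u, v \<in> V\<close>, so it centralizes
\<open>V\<close> by nondegeneracy.\<close>

lemma k_part_acts:
  assumes "x \<in> \<kk>"
  obtains y where "y \<in> k_of V" "\<And>u. u \<in> ideal_of V \<Longrightarrow> br x u = br y u"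
proof -
  interpret K: inner_product_on \<kk> "\<lambda>x y. - B x y"
    by (rule inner_product_on_k)
  have "subspace (k_of V)"
    by (simp add: k_of_def)
  then obtain y where y: "y \<in> k_of V" "\<And>w. w \<in> k_of V \<Longrightarrow> B (x - y) w = 0"
    using K.orthogonal_projection[OF _ k_of_k assms] by auto
  have xy: "x \<in> \<gg>" "y \<in> \<gg>" "x - y \<in> \<kk>"
    using assms y(1) k_of_k kD subspace_diff[OF subspace_k] by auto
  have "br (x - y) u = 0" if u: "u \<in> V" for u
  proof (rule B_nondegenerate_V)
    show "br (x - y) u \<in> V"
      using xy u by (intro k_V)
    fix v assume v: "v \<in> V"
    then have "B (br (x - y) u) v = B (x - y) (br u v)"
      using xy(3) kD V_in u by (intro B_invariant) auto
    then show "B (br (x - y) u) v = 0"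
      using y(2)[OF br_V[OF u v]] by simp
  qed
  then have "br (x - y) u = 0" if "u \<in> ideal_of V" for u
    using centralizes_ideal_of[OF kD[OF xy(3)] _ that] by blast
  then have "br x u = br y u" if "u \<in> ideal_of V" for u
    using that br_diff_left[OF xy(1,2) ideal_of_in[OF that]] by simp
  then show thesis
    using that y(1) by blast
qed

lemma orthogonal_p_centralizes:
  assumes "w \<in> \<pp>" "\<And>u. u \<in> V \<Longrightarrow> B w u = 0" "x \<in> ideal_of V"
  shows "br w x = 0"
proof (rule centralizes_ideal_of[OF pD[OF assms(1)] _ assms(3)])
  fix u assume "u \<in> V"
  then show "br w u = 0"
    using assms(1,2) V_p k_V by (intro orthogonal_commute) auto
qed

lemma algebra_acts:
  assumes "x \<in> \<gg>"
  obtains y where "y \<in> ideal_of V" "\<And>u. u \<in> ideal_of V \<Longrightarrow> br x u = br y u"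
proof -
  obtain a w where x: "a \<in> \<kk>" "w \<in> \<pp>" "x = a + w"
    using Cartan_decomposition[OF assms] by blast
  obtain b where b: "b \<in> k_of V" "\<And>u. u \<in> ideal_of V \<Longrightarrow> br a u = br b u"
    using k_part_acts[OF x(1)] by blast
  obtain v where v: "v \<in> V" "\<forall>u\<in>V. B (w - v) u = 0"
    using split x(2) by (auto simp: B_split_def)
  have "br (w - v) u = 0" if "u \<in> ideal_of V" for u
    using orthogonal_p_centralizes[OF _ _ that] v subspace_diff[OF subspace_p x(2)] V_p by blast
  then have "br w u = br v u" if "u \<in> ideal_of V" for u
    using that br_diff_left[OF pD[OF x(2)] V_in[OF v(1)] ideal_of_in[OF that]] by simp
  then have "br x u = br (b + v) u" if "u \<in> ideal_of V" for u
    using that x b v k_of_in V_in ideal_of_in kD pD by (simp add: br_add_left)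
  moreover have "b + v \<in> ideal_of V"
    using b v by (auto simp: ideal_of_def)
  ultimately show thesis
    using that by blast
qed

text \<open>An ideal of \<open>ideal_of V\<close> is an ideal of \<open>\<gg>\<close>, because every element of \<open>\<gg>\<close> acts on it as an element
of \<open>ideal_of V\<close>.\<close>

lemma semisimple_ideal_of: "semisimple (ideal_of V) br"
  unfolding semisimple_def
proof (intro allI impI)
  fix I assume I: "lie_ideal I (ideal_of V) br \<and> solvable_lie_algebra I br"
  have "br x u \<in> I" if x: "x \<in> \<gg>" and u: "u \<in> I" for x u
  proof -
    obtain y where "y \<in> ideal_of V" "\<And>u. u \<in> ideal_of V \<Longrightarrow> br x u = br y u"
      using algebra_acts[OF x] by blast
    then show ?thesis
      using I u by (auto simp: lie_ideal_def subset_iff)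
  qed
  then have "lie_ideal I \<gg> br"
    using I ideal_of_in by (auto simp: lie_ideal_def)
  then show "I = {0}"
    using I semisimple by (auto simp: semisimple_def)
qed

text \<open>For an ideal \<open>I\<close> inside \<open>\<kk>\<close>, the space \<open>[V,I]\<close> is contained in both \<open>I \<subseteq> \<kk>\<close> and \<open>\<pp>\<close>. So \<open>I\<close>
centralizes \<open>V\<close>, hence also \<open>[V,V]\<close>, and is abelian.\<close>

lemma strongly_effective_ideal_of: "strongly_effective (ideal_of V) br s"
  unfolding strongly_effective_def kpart_ideal_of
proof (intro allI impI)
  fix I assume I: "lie_ideal I (ideal_of V) br \<and> I \<subseteq> k_of V"
  have Ik: "y \<in> \<kk>" "y \<in> \<gg>" if "y \<in> I" for y
    using that I k_of_k kD by auto
  have "br y u = 0" if y: "y \<in> I" and u: "u \<in> V" for y u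
  proof -
    have "br u y \<in> \<kk>"
      using I y u V_subset Ik by (auto simp: lie_ideal_def)
    moreover have "br u y \<in> \<pp>"
      using br_pk V_p Ik u y by blast
    ultimately have "br u y = - br u y"
      using k_fix p_neg by metis
    then have "br u y = 0"
      using eq_neg_self_iff by blast
    then show ?thesis
      using br_commute[OF Ik(2)[OF y] V_in[OF u]] by simp
  qed
  then have "br y z = 0" if "y \<in> I" "z \<in> I" for y z
    using that centralizes_ideal_of[OF Ik(2)[OF that(1)]] I k_of_subset by blast
  then show "I = {0}"
    using lie_algebra.abelian_ideal_trivial[OF _ semisimple_ideal_of, of I] I
      symmetric_lie_algebra_ideal_of by (auto simp: symmetric_lie_algebra_def)
qed

lemma irreducible_ideal_of:
  assumes "k_irreducible V"
  shows "irreducible_symmetric (ideal_of V) br s"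
  unfolding irreducible_symmetric_def kpart_ideal_of ppart_ideal_of
proof (intro conjI allI impI)
  show "V \<noteq> {0}"
    using assms by (simp add: k_irreducible_def)
  fix U assume U: "subspace U \<and> U \<subseteq> V \<and> (\<forall>x\<in>k_of V. \<forall>v\<in>U. br x v \<in> U)"
  have "br x v \<in> U" if x: "x \<in> \<kk>" and v: "v \<in> U" for x v
  proof -
    obtain y where "y \<in> k_of V" "\<And>u. u \<in> ideal_of V \<Longrightarrow> br x u = br y u"
      using k_part_acts[OF x] by blast
    then show ?thesis
      using U v V_subset by auto
  qed
  then have "k_invariant U"
    using U V_p by (auto simp: k_invariant_def)
  then show "U = {0} \<or> U = V"
    using assms U by (auto simp: k_irreducible_def)
qed

text \<open>The elements \<open>x \<in> \<kk>\<close> and \<open>y \<in> [V,V]\<close> matched by \<open>k_part_acts\<close> have the same exponential on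
\<open>ideal_of V\<close>, so generators restrict to generators and all generators arise in this way.\<close>

lemma Int_group_ideal_of:
  "carrier (Int_group (ideal_of V) br (k_of V)) =
    (\<lambda>\<phi>. restrict \<phi> (ideal_of V)) ` carrier (Int_group \<gg> br \<kk>)"
proof -
  let ?G = "ideal_of V"
  interpret G: symmetric_lie_algebra ?G br s
    by (rule symmetric_lie_algebra_ideal_of)
  have g: "lie_algebra \<gg> br" and h: "lie_algebra ?G br"
    by unfold_locales
  have seg: "symmetric_exps \<gg> br \<kk>"
    using kD by (intro symmetric_exps g subspace_k) auto
  have seh: "symmetric_exps ?G br (k_of V)"
    using k_of_subset by (intro symmetric_exps h) (auto simp: k_of_def)
  define R where "R \<phi> \<psi> \<longleftrightarrow> \<psi> = restrict \<phi> ?G \<and> (\<forall>u\<in>?G. \<phi> u \<in> ?G)" for \<phi> \<psi> :: "'a \<Rightarrow> 'a"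
  have R_id: "R (\<lambda>y\<in>\<gg>. y) (\<lambda>y\<in>?G. y)"
    using ideal_of_in by (auto simp: R_def restrict_def)
  have R_compose: "R (compose \<gg> \<phi> \<phi>') (compose ?G \<psi> \<psi>')" if "R \<phi> \<psi>" "R \<phi>' \<psi>'" for \<phi> \<phi>' \<psi> \<psi>'
    using that ideal_of_in by (auto simp: R_def compose_def restrict_def)
  have R_exp: "R (exp_ad \<gg> br x) (exp_ad ?G br y)"
    if x: "x \<in> \<gg>" and y: "y \<in> ?G" and eq: "\<And>u. u \<in> ?G \<Longrightarrow> br x u = br y u" for x y
  proof -
    have "exp_ad \<gg> br x u = exp_ad ?G br y u" if "u \<in> ?G" for u
      using eq y that G.br_closed ideal_of_in by (intro exp_ad_cong[of ?G]) auto
    then show ?thesis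
      using exp_ad_in[OF h y] by (auto simp: R_def fun_eq_iff exp_ad_def restrict_def)
  qed
  have "\<exists>\<psi>\<in>carrier (Int_group ?G br (k_of V)). R \<phi> \<psi>" if "\<phi> \<in> carrier (Int_group \<gg> br \<kk>)" for \<phi>
    using seg seh that
  proof (rule Int_group_related)
    fix x assume x: "x \<in> \<kk>"
    obtain y where y: "y \<in> k_of V" "\<And>u. u \<in> ?G \<Longrightarrow> br x u = br y u"
      using k_part_acts[OF x] by blast
    then show "\<exists>x'\<in>k_of V. R (exp_ad \<gg> br x) (exp_ad ?G br x')"
      using R_exp[OF kD[OF x] k_of_subset] by blast
  qed (rule R_id, rule R_compose)
  moreover have "\<exists>\<phi>\<in>carrier (Int_group \<gg> br \<kk>). R \<phi> \<psi>"
    if "\<psi> \<in> carrier (Int_group ?G br (k_of V))" for \<psi>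
    using seh seg that
  proof (rule Int_group_related[where R = "\<lambda>\<psi> \<phi>. R \<phi> \<psi>"])
    fix x assume "x \<in> k_of V"
    then show "\<exists>x'\<in>\<kk>. R (exp_ad \<gg> br x') (exp_ad ?G br x)"
      using R_exp[OF k_of_in k_of_subset] k_of_k by blast
  qed (rule R_id, rule R_compose)
  ultimately show ?thesis
    by (auto simp: R_def image_iff)
qed

text \<open>Restriction is continuous for pointwise convergence, so it maps a compact group to a compact one.\<close>

lemma orthogonal_ideal_of:
  assumes "orthogonal_symmetric \<gg> br s"
  shows "orthogonal_symmetric (ideal_of V) br s"
  unfolding orthogonal_symmetric_def kpart_ideal_of Int_group_ideal_of
proof (rule compact_continuous_image)
  show "compact (carrier (Int_group \<gg> br \<kk>))"
    using assms by (simp add: orthogonal_symmetric_def)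
  show "continuous_on (carrier (Int_group \<gg> br \<kk>)) (\<lambda>\<phi>. restrict \<phi> (ideal_of V))"
  proof (rule continuous_on_coordinatewise_then_product)
    fix y
    show "continuous_on (carrier (Int_group \<gg> br \<kk>)) (\<lambda>\<phi>. restrict \<phi> (ideal_of V) y)"
      using continuous_on_subset[OF continuous_on_product_coordinates[of y]]
      by (cases "y \<in> ideal_of V") simp_all
  qed
qed

lemma irreducible_orthogonal_ideal_of:
  assumes "orthogonal_symmetric \<gg> br s" "k_irreducible V"
  shows "irreducible_orthogonal_symmetric_lie_algebra (ideal_of V) br s"
  using symmetric_lie_algebra_ideal_of orthogonal_ideal_of[OF assms(1)] semisimple_ideal_of
    strongly_effective_ideal_of irreducible_ideal_of[OF assms(2)]
  by (simp add: irreducible_orthogonal_symmetric_lie_algebra_def)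

end

end

section \<open>External direct sums\<close>

lemma lookup_scaleR: "Poly_Mapping.lookup (c *\<^sub>R f) i = c *\<^sub>R Poly_Mapping.lookup f i"
  by (simp add: scaleR_poly_mapping_def)

lemma bounded_linear_single:
  "bounded_linear (Poly_Mapping.single i :: 'a::real_normed_vector \<Rightarrow> _)"
proof
  show "Poly_Mapping.single i (a + b) = Poly_Mapping.single i a + Poly_Mapping.single i b" for a b :: 'a
    by (rule single_add)
  show "Poly_Mapping.single i (c *\<^sub>R a) = c *\<^sub>R Poly_Mapping.single i a" for c and a :: 'a
    by (rule poly_mapping_eqI) (simp add: lookup_scaleR lookup_single when_def)
  have "norm (Poly_Mapping.single i a) \<le> norm a * 1" for a :: 'a
    by (simp add: norm_poly_mapping_def dist_poly_mapping_def)
  then show "\<exists>K. \<forall>a::'a. norm (Poly_Mapping.single i a) \<le> norm a * K"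
    by blast
qed

definition family :: "nat \<Rightarrow> (nat \<Rightarrow> 'a::comm_monoid_add) \<Rightarrow> (nat \<Rightarrow>\<^sub>0 'a)" where
  "family m g = (\<Sum>i<m. Poly_Mapping.single i (g i))"

lemma lookup_family: "Poly_Mapping.lookup (family m g) i = (if i < m then g i else 0)"
  by (simp add: family_def lookup_sum lookup_single when_def)

lemma family_in: "(\<And>i. i < m \<Longrightarrow> g i \<in> G i) \<Longrightarrow> family m g \<in> ext_sum m G"
  by (simp add: ext_sum_def lookup_family)

lemma family_lookup: "f \<in> ext_sum m G \<Longrightarrow> family m (Poly_Mapping.lookup f) = f"
  by (rule poly_mapping_eqI) (simp add: ext_sum_def lookup_family)

lemma ext_sumD: "f \<in> ext_sum m G \<Longrightarrow> i < m \<Longrightarrow> Poly_Mapping.lookup f i \<in> G i"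
  by (simp add: ext_sum_def)

lemma ext_br_eq: "ext_br m br f h = family m (\<lambda>i. br (Poly_Mapping.lookup f i) (Poly_Mapping.lookup h i))"
  by (simp add: ext_br_def family_def)

lemma ext_inv_eq: "ext_inv m s f = family m (\<lambda>i. s (Poly_Mapping.lookup f i))"
  by (simp add: ext_inv_def family_def)

lemma kpart_ext_sum: "kpart (ext_sum m G) (ext_inv m s) = ext_sum m (\<lambda>i. kpart (G i) s)"
  by (auto simp: kpart_def ext_sum_def ext_inv_eq poly_mapping_eq_iff fun_eq_iff lookup_family)

lemma ppart_ext_sum:
  "ppart (ext_sum m G) (ext_inv m s) = ext_sum m (\<lambda>i. ppart (G i) s)"
  by (auto simp: ppart_def ext_sum_def ext_inv_eq poly_mapping_eq_iff fun_eq_iff lookup_family)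

text \<open>The bracket is componentwise, so its powers are, and each component is embedded by a bounded linear
map.\<close>

lemma exp_ad_ext_sum:
  fixes G :: "nat \<Rightarrow> 'a::euclidean_space set"
  assumes G: "\<And>i. i < m \<Longrightarrow> lie_algebra (G i) br"
    and X: "X \<in> ext_sum m G" and f: "f \<in> ext_sum m G"
  shows "exp_ad (ext_sum m G) (ext_br m br) X f =
    family m (\<lambda>i. exp_ad (G i) br (Poly_Mapping.lookup X i) (Poly_Mapping.lookup f i))"
proof -
  let ?X = "Poly_Mapping.lookup X" and ?f = "Poly_Mapping.lookup f"
  have power: "(ext_br m br X ^^ k) f = family m (\<lambda>i. (br (?X i) ^^ k) (?f i))" for k
  proof (induction k)
    case 0
    then show ?case using family_lookup[OF f] by simp
  next
    case (Suc k)
    then show ?case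
      by (simp add: ext_br_eq) (simp add: family_def lookup_sum lookup_single when_def)
  qed
  have "(\<lambda>k. \<Sum>i<m. Poly_Mapping.single i ((br (?X i) ^^ k) (?f i) /\<^sub>R fact k)) sums
      (\<Sum>i<m. Poly_Mapping.single i (exp_ad (G i) br (?X i) (?f i)))"
    using ext_sumD[OF X] ext_sumD[OF f] G
    by (intro sums_sum bounded_linear.sums[OF bounded_linear_single] exp_ad_sums) auto
  then have "(\<lambda>k. (ext_br m br X ^^ k) f /\<^sub>R fact k) sums
      family m (\<lambda>i. exp_ad (G i) br (?X i) (?f i))"
    by (simp add: power family_def scaleR_sum_right
        linear_scale[OF bounded_linear.linear[OF bounded_linear_single]])
  then show ?thesis
    using f by (simp add: exp_ad_def[of "ext_sum m G"] sums_iff)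
qed

lemma symmetric_exps_ext_sum:
  fixes G :: "nat \<Rightarrow> 'a::euclidean_space set"
  assumes G: "\<And>i. i < m \<Longrightarrow> lie_algebra (G i) br"
    and K: "\<And>i. i < m \<Longrightarrow> subspace (K i) \<and> K i \<subseteq> G i"
  shows "symmetric_exps (ext_sum m G) (ext_br m br) (ext_sum m K)"
  unfolding symmetric_exps_def
proof (intro ballI)
  fix X assume X: "X \<in> ext_sum m K"
  let ?D = "ext_sum m G" and ?e = "exp_ad (ext_sum m G) (ext_br m br)"
  have mX: "- X \<in> ext_sum m K"
    using X K by (auto simp: ext_sum_def subspace_neg)
  have D: "Y \<in> ?D" if "Y \<in> ext_sum m K" for Y
    using that K by (auto simp: ext_sum_def)
  have e: "?e Y f = family m
      (\<lambda>i. exp_ad (G i) br (Poly_Mapping.lookup Y i) (Poly_Mapping.lookup f i))"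
    if "Y \<in> ?D" "f \<in> ?D" for Y f
    by (rule exp_ad_ext_sum[OF G that])
  have closed: "?e Y f \<in> ?D" if "Y \<in> ?D" "f \<in> ?D" for Y f
    unfolding e[OF that]
    using ext_sumD[OF that(1)] ext_sumD[OF that(2)] G by (intro family_in exp_ad_in) auto
  have inverse: "?e (- Y) (?e Y f) = f" if Y: "Y \<in> ?D" "- Y \<in> ?D" and f: "f \<in> ?D" for Y f
  proof -
    have "?e (- Y) (?e Y f) = family m (\<lambda>i. exp_ad (G i) br (Poly_Mapping.lookup (- Y) i)
        (Poly_Mapping.lookup (?e Y f) i))"
      by (rule e[OF Y(2) closed[OF Y(1) f]])
    also have "\<dots> = family m (Poly_Mapping.lookup f)"
      unfolding family_def e[OF Y(1) f, unfolded family_def]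
      using ext_sumD[OF Y(1)] ext_sumD[OF f] G
      by (intro sum.cong refl) (simp add: lookup_sum lookup_single when_def exp_ad_minus)
    finally show ?thesis
      using family_lookup[OF f] by simp
  qed
  have "?e X (?e (- X) f) = f" if "f \<in> ?D" for f
    using inverse[of "- X" f] D[OF X] D[OF mX] that by simp
  then have "?e X \<in> Bij ?D \<and> inv\<^bsub>BijGroup ?D\<^esub> (?e X) = ?e (- X)"
    using Bij_inverse_pair[of "?e X" ?D "?e (- X)"] exp_ad_extensional closed inverse
      D[OF X] D[OF mX] by blast
  then show "- X \<in> ext_sum m K \<and> ?e X \<in> Bij ?D \<and> inv\<^bsub>BijGroup ?D\<^esub> (?e X) = ?e (- X)"
    using mX by blast
qed

text \<open>If \<open>x \<in> \<kk>\<close> and a tuple \<open>X\<close> act in the same way on all \<open>-1\<close> eigenspaces of the summands, then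
\<open>exp (ad x)\<close> and \<open>exp (ad X)\<close> are intertwined by \<open>sum_map m\<close>. The premises match generators in both
directions, so \<open>Int_group_related\<close> matches the groups.\<close>

lemma orbit_equivalent_via_sum_map:
  fixes \<gg> :: "'a::euclidean_space set"
  assumes g: "symmetric_lie_algebra \<gg> br s"
    and G: "\<And>i. i < m \<Longrightarrow> symmetric_lie_subalgebra (G i) \<gg> br s"
    and direct: "internal_direct_sum m (\<lambda>i. ppart (G i) s) (ppart \<gg> s)"
    and to_sum: "\<And>x. x \<in> kpart \<gg> s \<Longrightarrow> \<exists>X\<in>ext_sum m (\<lambda>i. kpart (G i) s).
      \<forall>i<m. \<forall>u\<in>ppart (G i) s. br x u = br (Poly_Mapping.lookup X i) u"
    and from_sum: "\<And>X. X \<in> ext_sum m (\<lambda>i. kpart (G i) s) \<Longrightarrow> \<exists>x\<in>kpart \<gg> s.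
      \<forall>i<m. \<forall>u\<in>ppart (G i) s. br x u = br (Poly_Mapping.lookup X i) u"
  shows "orbit_equivalent_via (sum_map m) \<gg> br s (ext_sum m G) (ext_br m br) (ext_inv m s)"
proof -
  interpret symmetric_lie_algebra \<gg> br s by fact
  let ?D = "ext_sum m G" and ?K = "ext_sum m (\<lambda>i. kpart (G i) s)"
    and ?P = "ext_sum m (\<lambda>i. ppart (G i) s)"
  have Gi: "symmetric_lie_algebra (G i) br s" "G i \<subseteq> \<gg>" if "i < m" for i
    using symmetric_lie_subalgebra_algebra[OF g G[OF that]] G[OF that]
    by (auto simp: symmetric_lie_subalgebra_def)
  have Gl: "lie_algebra (G i) br" if "i < m" for i
    using Gi(1)[OF that] by (simp add: symmetric_lie_algebra_def)
  have gl: "lie_algebra \<gg> br" by unfold_locales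
  have KG: "subspace (kpart (G i) s) \<and> kpart (G i) s \<subseteq> G i" if "i < m" for i
    using symmetric_lie_algebra.subspace_k[OF Gi(1)[OF that]] by (auto simp: kpart_def)
  have PD: "v \<in> ?D" if "v \<in> ?P" for v
    using that by (auto simp: ext_sum_def ppart_def)
  have Pg: "Poly_Mapping.lookup v i \<in> \<gg>" if "v \<in> ?P" "i < m" for v i
    using ext_sumD[OF PD[OF that(1)] that(2)] Gi(2)[OF that(2)] by blast
  have sum_in: "sum_map m v \<in> \<gg>" if "v \<in> ?P" for v
    unfolding sum_map_def using Pg[OF that] by (intro subspace_sum subspace) auto
  have seg: "symmetric_exps \<gg> br \<kk>"
    using kD by (intro symmetric_exps gl subspace_k) auto
  have seD: "symmetric_exps ?D (ext_br m br) ?K"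
    by (rule symmetric_exps_ext_sum[OF Gl KG])
  define R where "R \<phi> \<psi> \<longleftrightarrow> (\<forall>v\<in>?P. \<psi> v \<in> ?P \<and> \<phi> (sum_map m v) = sum_map m (\<psi> v))"
    for \<phi> :: "'a \<Rightarrow> 'a" and \<psi> :: "(nat \<Rightarrow>\<^sub>0 'a) \<Rightarrow> (nat \<Rightarrow>\<^sub>0 'a)"
  have R_id: "R (\<lambda>y\<in>\<gg>. y) (\<lambda>y\<in>?D. y)"
    using PD sum_in by (simp add: R_def)
  have R_compose: "R (compose \<gg> \<phi> \<phi>') (compose ?D \<psi> \<psi>')" if "R \<phi> \<psi>" "R \<phi>' \<psi>'" for \<phi> \<phi>' \<psi> \<psi>'
    using that PD sum_in by (simp add: R_def compose_def)
  have R_exp: "R (exp_ad \<gg> br x) (exp_ad ?D (ext_br m br) X)"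
    if x: "x \<in> \<kk>" and X: "X \<in> ?K"
      and eq: "\<forall>i<m. \<forall>u\<in>ppart (G i) s. br x u = br (Poly_Mapping.lookup X i) u" for x X
    unfolding R_def
  proof (intro ballI)
    fix v assume v: "v \<in> ?P"
    let ?X = "Poly_Mapping.lookup X" and ?v = "Poly_Mapping.lookup v"
    have XD: "X \<in> ?D"
      using X KG by (auto simp: ext_sum_def)
    have comp: "exp_ad \<gg> br x (?v i) = exp_ad (G i) br (?X i) (?v i) \<and>
        exp_ad (G i) br (?X i) (?v i) \<in> ppart (G i) s" if i: "i < m" for i
    proof
      have inv: "br (?X i) u \<in> ppart (G i) s" if "u \<in> ppart (G i) s" for u
        using symmetric_lie_algebra.br_kp[OF Gi(1)[OF i] ext_sumD[OF X i] that] .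
      show "exp_ad \<gg> br x (?v i) = exp_ad (G i) br (?X i) (?v i)"
        using eq i inv ext_sumD[OF v i] Gi(2)[OF i]
        by (intro exp_ad_cong[of "ppart (G i) s"]) (auto simp: ppart_def)
      show "exp_ad (G i) br (?X i) (?v i) \<in> ppart (G i) s"
        using inv ext_sumD[OF XD i] ext_sumD[OF v i] symmetric_lie_algebra.subspace_p[OF Gi(1)[OF i]]
        by (intro exp_ad_closed Gl i) (auto simp: ppart_def)
    qed
    have exp_sum: "exp_ad \<gg> br x (\<Sum>i\<in>I. ?v i) = (\<Sum>i\<in>I. exp_ad \<gg> br x (?v i))"
      if "finite I" "I \<subseteq> {..<m}" for I
      using that
    proof (induction rule: finite_induct)
      case empty
      show ?case
        using exp_ad_linear(2)[OF gl kD[OF x] zero_in zero_in, of 0] by simp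
    next
      case (insert i I)
      have "(\<Sum>i\<in>I. ?v i) \<in> \<gg>"
        using insert Pg[OF v] by (intro subspace_sum subspace) auto
      then show ?case
        using insert Pg[OF v] exp_ad_linear(1)[OF gl kD[OF x]] by simp
    qed
    have e: "exp_ad ?D (ext_br m br) X v = family m (\<lambda>i. exp_ad (G i) br (?X i) (?v i))"
      by (rule exp_ad_ext_sum[OF Gl XD PD[OF v]])
    have "exp_ad \<gg> br x (sum_map m v) = (\<Sum>i<m. exp_ad (G i) br (?X i) (?v i))"
      unfolding sum_map_def using exp_sum[of "{..<m}"] comp by simp
    then show "exp_ad ?D (ext_br m br) X v \<in> ?P \<and>
        exp_ad \<gg> br x (sum_map m v) = sum_map m (exp_ad ?D (ext_br m br) X v)"
      unfolding e using comp by (auto simp: sum_map_def lookup_family intro!: family_in)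
  qed
  have forward: "\<exists>\<psi>\<in>carrier (Int_group ?D (ext_br m br) ?K). R \<phi> \<psi>"
    if "\<phi> \<in> carrier (Int_group \<gg> br \<kk>)" for \<phi>
    using seg seD that
  proof (rule Int_group_related)
    show "\<exists>X\<in>?K. R (exp_ad \<gg> br x) (exp_ad ?D (ext_br m br) X)" if "x \<in> \<kk>" for x
      using to_sum[OF that] R_exp[OF that] by blast
  qed (rule R_id, rule R_compose)
  have backward: "\<exists>\<phi>\<in>carrier (Int_group \<gg> br \<kk>). R \<phi> \<psi>"
    if "\<psi> \<in> carrier (Int_group ?D (ext_br m br) ?K)" for \<psi>
    using seD seg that
  proof (rule Int_group_related[where R = "\<lambda>\<psi> \<phi>. R \<phi> \<psi>"])
    show "\<exists>x\<in>\<kk>. R (exp_ad \<gg> br x) (exp_ad ?D (ext_br m br) X)" if "X \<in> ?K" for X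
      using from_sum[OF that] R_exp[OF _ that] by blast
  qed (rule R_id, rule R_compose)
  have bij: "bij_betw (sum_map m) ?P \<pp>"
    using direct by (simp add: internal_direct_sum_def)
  then have sum_p: "sum_map m v \<in> \<pp>" if "v \<in> ?P" for v
    using that by (rule bij_betw_apply)
  have orbit_eq: "orbit (Int_group \<gg> br \<kk>) (\<lambda>\<phi>. restrict \<phi> \<pp>) (sum_map m v) =
     sum_map m ` orbit (Int_group ?D (ext_br m br) ?K) (\<lambda>\<psi>. restrict \<psi> ?P) v" if v: "v \<in> ?P" for v
  proof (intro equalityI subsetI)
    fix y assume "y \<in> orbit (Int_group \<gg> br \<kk>) (\<lambda>\<phi>. restrict \<phi> \<pp>) (sum_map m v)"
    then obtain \<phi> where \<phi>: "\<phi> \<in> carrier (Int_group \<gg> br \<kk>)" "y = \<phi> (sum_map m v)"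
      using sum_p[OF v] by (auto simp: orbit_def)
    obtain \<psi> where \<psi>: "\<psi> \<in> carrier (Int_group ?D (ext_br m br) ?K)" "R \<phi> \<psi>"
      using forward[OF \<phi>(1)] by blast
    have "y = sum_map m (restrict \<psi> ?P v)"
      using \<psi>(2) \<phi>(2) v by (simp add: R_def)
    then show "y \<in> sum_map m ` orbit (Int_group ?D (ext_br m br) ?K) (\<lambda>\<psi>. restrict \<psi> ?P) v"
      using \<psi>(1) unfolding orbit_def by blast
  next
    fix y assume "y \<in> sum_map m ` orbit (Int_group ?D (ext_br m br) ?K) (\<lambda>\<psi>. restrict \<psi> ?P) v"
    then obtain \<psi> where \<psi>: "\<psi> \<in> carrier (Int_group ?D (ext_br m br) ?K)" "y = sum_map m (\<psi> v)"
      using v by (auto simp: orbit_def)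
    obtain \<phi> where \<phi>: "\<phi> \<in> carrier (Int_group \<gg> br \<kk>)" "R \<phi> \<psi>"
      using backward[OF \<psi>(1)] by blast
    have "y = restrict \<phi> \<pp> (sum_map m v)"
      using \<phi>(2) \<psi>(2) v sum_p[OF v] by (simp add: R_def)
    then show "y \<in> orbit (Int_group \<gg> br \<kk>) (\<lambda>\<phi>. restrict \<phi> \<pp>) (sum_map m v)"
      using \<phi>(1) unfolding orbit_def by blast
  qed
  have "isotropy_orbits \<gg> br s =
      (\<lambda>x. orbit (Int_group \<gg> br \<kk>) (\<lambda>\<phi>. restrict \<phi> \<pp>) x) ` sum_map m ` ?P"
    using bij by (auto simp: isotropy_orbits_def orbits_def bij_betw_def)
  also have "\<dots> = (\<lambda>orb. sum_map m ` orb) ` (\<lambda>v. orbit (Int_group ?D (ext_br m br) ?K)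
      (\<lambda>\<psi>. restrict \<psi> ?P) v) ` ?P"
    using orbit_eq by (simp add: image_image cong: image_cong)
  also have "(\<lambda>v. orbit (Int_group ?D (ext_br m br) ?K) (\<lambda>\<psi>. restrict \<psi> ?P) v) ` ?P =
      isotropy_orbits ?D (ext_br m br) (ext_inv m s)"
    by (auto simp: isotropy_orbits_def orbits_def kpart_ext_sum ppart_ext_sum)
  finally show ?thesis
    using bij by (simp add: orbit_equivalent_via_def ppart_ext_sum)
qed

section \<open>Decomposition up to orbit equivalence\<close>

context symmetric_lie_algebra_with_inner_product
begin

text \<open>Taking the product of the sum with \<open>d i\<close> leaves only \<open>q (d i) (d i)\<close>. This is the directness of
the sum.\<close>

lemma orthogonal_sum_zero:
  fixes n :: nat
  assumes V: "\<And>i. i < n \<Longrightarrow> V i \<subseteq> \<gg>"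
    and orth: "\<And>i j u v. \<lbrakk>i < n; j < n; i \<noteq> j; u \<in> V i; v \<in> V j\<rbrakk> \<Longrightarrow> q u v = 0"
    and d: "\<And>i. i < n \<Longrightarrow> d i \<in> V i" and "(\<Sum>i<n. d i) = 0" and "i < n"
  shows "d i = 0"
proof -
  have dg: "d j \<in> \<gg>" if "j < n" for j
    using V d that by blast
  have "0 = q (\<Sum>j<n. 1 *\<^sub>R d j) (d i)"
    using assms(4) zero_left[OF dg[OF \<open>i < n\<close>]] by simp
  also have "\<dots> = (\<Sum>j<n. 1 * q (d j) (d i))"
    using dg \<open>i < n\<close> by (intro sum_left) auto
  also have "\<dots> = (\<Sum>j<n. if j = i then q (d i) (d i) else 0)"
    using orth d \<open>i < n\<close> by (intro sum.cong) auto
  also have "\<dots> = q (d i) (d i)"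
    using \<open>i < n\<close> by simp
  finally show ?thesis
    using eq_zero_iff[OF dg[OF \<open>i < n\<close>]] by simp
qed

lemma B_split_summand:
  fixes n :: nat
  assumes V: "\<And>i. i < n \<Longrightarrow> k_invariant (V i)"
    and orth: "\<And>i j u v. \<lbrakk>i < n; j < n; i \<noteq> j; u \<in> V i; v \<in> V j\<rbrakk> \<Longrightarrow> B u v = 0"
    and sum: "\<And>w. w \<in> \<pp> \<Longrightarrow> \<exists>v. (\<forall>i<n. v i \<in> V i) \<and> w = (\<Sum>i<n. v i)" and i: "i < n"
  shows "B_split (V i)"
  unfolding B_split_def
proof (intro conjI V[OF i] ballI)
  fix w assume "w \<in> \<pp>"
  then obtain v where v: "\<forall>j<n. v j \<in> V j" "w = (\<Sum>j<n. v j)"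
    using sum by blast
  have Vg: "u \<in> \<gg>" if "u \<in> V j" "j < n" for j u
    using V[OF that(2)] that(1) pD by (auto simp: k_invariant_def)
  have "B (w - v i) u = 0" if u: "u \<in> V i" for u
  proof -
    have "w - v i = (\<Sum>j\<in>{..<n} - {i}. 1 *\<^sub>R v j)"
      using v(2) i by (simp add: sum_diff1)
    also have "B \<dots> u = (\<Sum>j\<in>{..<n} - {i}. 1 * B (v j) u)"
      using v(1) Vg u i by (intro B.sum_left) auto
    also have "\<dots> = 0"
      using orth[OF _ i _ _ u] v(1) by (intro sum.neutral) auto
    finally show ?thesis .
  qed
  then show "\<exists>v\<in>V i. \<forall>u\<in>V i. B (w - v) u = 0"
    using v(1) i by blast
qed

end

theorem theorem3p10:
  fixes \<gg> :: "'a::euclidean_space set"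
    and br :: "'a \<Rightarrow> 'a \<Rightarrow> 'a"
    and s :: "'a \<Rightarrow> 'a"
  assumes "symmetric_lie_algebra \<gg> br s"
    and "semisimple \<gg> br"
    and "orthogonal_symmetric \<gg> br s"
  shows "\<exists>(n::nat) (\<gg>i :: nat \<Rightarrow> 'a set) (\<gg>' :: 'a set).
    (\<forall>i<n. symmetric_lie_subalgebra (\<gg>i i) \<gg> br s \<and>
            irreducible_orthogonal_symmetric_lie_algebra (\<gg>i i) br s) \<and>
    symmetric_lie_subalgebra \<gg>' \<gg> br s \<and>
    trivial_isotropy \<gg>' br s \<and>
    internal_direct_sum (Suc n)
      ((\<lambda>i. ppart (\<gg>i i) s)(n := ppart \<gg>' s)) (ppart \<gg> s) \<and>
    orbit_equivalent_via (sum_map (Suc n)) \<gg> br s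
      (ext_sum (Suc n) (\<gg>i(n := \<gg>'))) (ext_br (Suc n) br) (ext_inv (Suc n) s)"
proof -
  obtain q E where "symmetric_lie_algebra_with_inner_product \<gg> br s q E"
    using ex_invariant_inner_product[OF assms] by blast
  then interpret symmetric_lie_algebra_with_inner_product \<gg> br s q E .
  have "k_invariant \<pp>"
    by (simp add: k_invariant_def subspace_p br_kp)
  from k_irreducible_decomposition[OF this]
  obtain n :: nat and V where V: "\<forall>i<n. k_irreducible (V i) \<and> V i \<subseteq> \<pp>"
    and orth: "\<forall>i<n. \<forall>j<n. i \<noteq> j \<longrightarrow> (\<forall>u\<in>V i. \<forall>v\<in>V j. q u v = 0 \<and> B u v = 0)"
    and sum: "\<forall>w\<in>\<pp>. \<exists>v. (\<forall>i<n. v i \<in> V i) \<and> w = (\<Sum>i<n. v i)"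
    by (elim exE conjE) (rule that)
  have inv: "k_invariant (V i)" if "i < n" for i
    using V that by (simp add: k_irreducible_def)
  have split: "B_split (V i)" if "i < n" for i
    by (rule B_split_summand[OF inv _ _ that]) (use orth sum in blast)+
  define G where "G = (\<lambda>i. ideal_of (V i))(n := {0})"
  have G_less: "G i = ideal_of (V i)" if "i < n" for i
    using that by (simp add: G_def)
  have G_n: "G n = {0}"
    by (simp add: G_def)
  have sub_0: "symmetric_lie_subalgebra {0} \<gg> br s"
    using zero_in s_zero br_self by (simp add: symmetric_lie_subalgebra_def)
  have G_sub: "symmetric_lie_subalgebra (G i) \<gg> br s" if "i < Suc n" for i
    using that symmetric_lie_subalgebra_ideal_of[OF split] sub_0 G_less G_n
    by (auto simp: less_Suc_eq)
  have kG: "kpart (G i) s = k_of (V i)" and pG: "ppart (G i) s = V i" if "i < n" for i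
    using kpart_ideal_of ppart_ideal_of split that by (simp_all add: G_less)
  have kG_n: "kpart (G n) s = {0}" and pG_n: "ppart (G n) s = {0}"
    using s_zero by (auto simp: G_n kpart_def ppart_def)
  have pG_p: "ppart (G i) s \<subseteq> \<pp>" if "i < Suc n" for i
    using that V pG pG_n subspace_0[OF subspace_p] by (auto simp: less_Suc_eq)
  have orth': "q u v = 0" if "i < Suc n" "j < Suc n" "i \<noteq> j" "u \<in> ppart (G i) s" "v \<in> ppart (G j) s" for i j u v
  proof -
    have "u \<in> \<gg>" "v \<in> \<gg>"
      using that pG_p pD by blast+
    then show ?thesis
      using that orth pG pG_n zero_left zero_right by (auto simp: less_Suc_eq)
  qed
  have direct: "internal_direct_sum (Suc n) (\<lambda>i. ppart (G i) s) \<pp>"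
    unfolding internal_direct_sum_def bij_betw_def
  proof (intro conjI inj_onI equalityI subsetI)
    fix f h assume f: "f \<in> ext_sum (Suc n) (\<lambda>i. ppart (G i) s)"
      and h: "h \<in> ext_sum (Suc n) (\<lambda>i. ppart (G i) s)" and eq: "sum_map (Suc n) f = sum_map (Suc n) h"
    let ?d = "\<lambda>i. Poly_Mapping.lookup f i - Poly_Mapping.lookup h i"
    have "?d i = 0" if "i < Suc n" for i
    proof (rule orthogonal_sum_zero[where V = "\<lambda>i. ppart (G i) s" and n = "Suc n"])
      show "ppart (G i) s \<subseteq> \<gg>" if "i < Suc n" for i
        using pG_p[OF that] pD by blast
      show "?d i \<in> ppart (G i) s" if "i < Suc n" for i
        using symmetric_lie_subalgebra_algebra[OF assms(1) G_sub[OF that],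
            THEN symmetric_lie_algebra.subspace_p] ext_sumD[OF f that] ext_sumD[OF h that]
        by (rule subspace_diff)
      show "(\<Sum>i<Suc n. ?d i) = 0"
        using eq by (simp add: sum_map_def sum_subtractf)
    qed (use orth' that in auto)
    then show "f = h"
      using f h by (intro poly_mapping_eqI) (metis (mono_tags, lifting) ext_sum_def
          eq_iff_diff_eq_0 mem_Collect_eq not_le)
  next
    fix y assume "y \<in> sum_map (Suc n) ` ext_sum (Suc n) (\<lambda>i. ppart (G i) s)"
    then obtain f where f: "f \<in> ext_sum (Suc n) (\<lambda>i. ppart (G i) s)" "y = sum_map (Suc n) f"
      by blast
    have "(\<Sum>i<Suc n. Poly_Mapping.lookup f i) \<in> \<pp>"
      using ext_sumD[OF f(1)] pG_p by (intro subspace_sum subspace_p) auto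
    then show "y \<in> \<pp>"
      using f(2) by (simp add: sum_map_def)
  next
    fix w assume "w \<in> \<pp>"
    then obtain v where v: "\<forall>i<n. v i \<in> V i" "w = (\<Sum>i<n. v i)"
      using sum by blast
    let ?f = "family (Suc n) (v(n := 0))"
    have "?f \<in> ext_sum (Suc n) (\<lambda>i. ppart (G i) s)"
      using v(1) pG pG_n by (intro family_in) (auto simp: less_Suc_eq)
    moreover have "w = sum_map (Suc n) ?f"
      using v(2) by (simp add: sum_map_def lookup_family)
    ultimately show "w \<in> sum_map (Suc n) ` ext_sum (Suc n) (\<lambda>i. ppart (G i) s)"
      by blast
  qed
  have "orbit_equivalent_via (sum_map (Suc n)) \<gg> br s
      (ext_sum (Suc n) G) (ext_br (Suc n) br) (ext_inv (Suc n) s)"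
  proof (rule orbit_equivalent_via_sum_map[OF assms(1) G_sub direct])
    fix x assume x: "x \<in> \<kk>"
    have "\<exists>y\<in>kpart (G i) s. \<forall>u\<in>ppart (G i) s. br x u = br y u" if "i < Suc n" for i
    proof (cases "i = n")
      case True
      then show ?thesis
        using kD[OF x] zero_in by (simp add: kG_n pG_n br_zero_right)
    next
      case False
      with that have i: "i < n" by simp
      obtain y where "y \<in> k_of (V i)" "\<And>u. u \<in> ideal_of (V i) \<Longrightarrow> br x u = br y u"
        using k_part_acts[OF split[OF i] x] by blast
      then show ?thesis
        using V_subset[OF split[OF i]] by (auto simp: kG[OF i] pG[OF i])
    qed
    then obtain y where y: "\<And>i. i < Suc n \<Longrightarrow> y i \<in> kpart (G i) s \<and>
        (\<forall>u\<in>ppart (G i) s. br x u = br (y i) u)"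
      by metis
    then show "\<exists>X\<in>ext_sum (Suc n) (\<lambda>i. kpart (G i) s). \<forall>i<Suc n. \<forall>u\<in>ppart (G i) s.
        br x u = br (Poly_Mapping.lookup X i) u"
      by (intro bexI[of _ "family (Suc n) y"] family_in) (auto simp: lookup_family)
  next
    fix X assume X: "X \<in> ext_sum (Suc n) (\<lambda>i. kpart (G i) s)"
    let ?X = "Poly_Mapping.lookup X"
    have Xk: "?X i \<in> \<kk>" if "i < Suc n" for i
      using ext_sumD[OF X that] G_sub[OF that] by (auto simp: symmetric_lie_subalgebra_def kpart_def)
    \<comment> \<open>Different summands commute, so only the \<open>i\<close>-th component of the tuple acts on the \<open>i\<close>-th summand.\<close>
    have kill: "br (?X j) u = 0" if i: "i < Suc n" and j: "j < Suc n" and "i \<noteq> j" and u: "u \<in> ppart (G i) s" for i j u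
    proof (cases "i = n \<or> j = n")
      case True
      have "u \<in> \<gg>" "?X j \<in> \<gg>"
        using u pG_p[OF i] pD Xk[OF j] kD by blast+
      then show ?thesis
        using True u ext_sumD[OF X j] by (auto simp: kG_n pG_n br_zero_left br_zero_right)
    next
      case False
      then have ij: "i < n" "j < n"
        using i j by auto
      have uV: "u \<in> V i" "u \<in> \<pp>"
        using u pG[OF ij(1)] pG_p[OF i] by auto
      have XV: "?X j \<in> k_of (V j)"
        using ext_sumD[OF X j] kG[OF ij(2)] by simp
      have "br u (?X j) = 0"
        using orth ij \<open>i \<noteq> j\<close> uV
        by (intro orthogonal_p_centralizes[OF split[OF ij(2)] _ _ k_of_subset[OF split[OF ij(2)] XV]]) auto
      then show ?thesis
        using br_commute[of "?X j" u] uV(2) pD Xk[OF j] kD by simp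
    qed
    have act: "br (\<Sum>j\<in>J. ?X j) u = (\<Sum>j\<in>J. br (?X j) u)"
      if "finite J" "J \<subseteq> {..<Suc n}" "u \<in> \<gg>" for J u
      using that(1,2)
    proof (induction rule: finite_induct)
      case empty
      then show ?case by (simp add: br_zero_left that(3))
    next
      case (insert j J)
      have "(\<Sum>j\<in>J. ?X j) \<in> \<kk>"
        using insert Xk by (intro subspace_sum subspace_k) auto
      then show ?case
        using insert Xk kD that(3) by (simp add: br_add_left)
    qed
    have "br (\<Sum>j<Suc n. ?X j) u = br (?X i) u" if i: "i < Suc n" and u: "u \<in> ppart (G i) s" for i u
    proof -
      have "br (\<Sum>j<Suc n. ?X j) u = (\<Sum>j<Suc n. br (?X j) u)"
        using u pG_p[OF i] pD by (intro act) auto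
      also have "\<dots> = (\<Sum>j<Suc n. if j = i then br (?X i) u else 0)"
        using kill i u by (intro sum.cong) auto
      also have "\<dots> = br (?X i) u"
        using i by simp
      finally show ?thesis .
    qed
    moreover have "(\<Sum>j<Suc n. ?X j) \<in> \<kk>"
      using Xk by (intro subspace_sum subspace_k) auto
    ultimately show "\<exists>x\<in>\<kk>. \<forall>i<Suc n. \<forall>u\<in>ppart (G i) s. br x u = br (?X i) u"
      by blast
  qed
  moreover have "(\<lambda>i. ppart (G i) s) = (\<lambda>i. ppart (ideal_of (V i)) s)(n := ppart {0} s)"
    by (simp add: G_def fun_eq_iff)
  moreover have "trivial_isotropy {0} br s"
    using br_self[OF zero_in] by (auto simp: trivial_isotropy_def kpart_def ppart_def)
  moreover have "symmetric_lie_subalgebra (ideal_of (V i)) \<gg> br s \<and>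
      irreducible_orthogonal_symmetric_lie_algebra (ideal_of (V i)) br s" if "i < n" for i
    using symmetric_lie_subalgebra_ideal_of[OF split[OF that]]
      irreducible_orthogonal_ideal_of[OF split[OF that] assms(3)] V that by blast
  ultimately show ?thesis
    using direct sub_0 unfolding G_def
    by (intro exI[of _ n] exI[of _ "\<lambda>i. ideal_of (V i)"] exI[of _ "{0}"] conjI allI impI) auto
qed

end
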